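(* Finite expansions with respect to each of the pairs $(U,D)$, $(D,U)$, $(U,K)$, $(K,D)$, $(U,\overline{K})$ and $(\overline{K},D)$ are unique.
   Context: $\mathrm{Sym}$ is the algebra of symmetric functions over $\mathbb{Q}$, with Schur basis $(s_\lambda)$, power sums $p_\lambda$, complete homogeneous functions $h_n$ ($h_0=1$, $h_n=0$ for $n<0$), and the Hall inner product (Schur functions orthonormal). The Kronecker product $\ast$ is the bilinear product on $\mathrm{Sym}$ with $p_\lambda\ast p_\mu=\delta_{\lambda\mu}z_\lambda p_\lambda$, where $z_\lambda=\prod_i i^{m_i}m_i!$ and $m_i$ is the number of parts of $\lambda$ equal to $i$. For $f\in\mathrm{Sym}$: $U_f(g)=fg$; $D_f$ is the adjoint of $U_f$ for the Hall inner product; $K_f(g)=f\ast g$. For a partition $\lambda$ and $g$ homogeneous of degree $n$, $\overline{K}_\lambda(g)=s_{(n-|\lambda|,\lambda_1,\lambda_2,\ldots)}\ast g$, extended linearly in $g$, where for any integer sequence $s_{(\alpha_1,\ldots,\alpha_N)}=\det(h_{\alpha_i+j-i})_{i,j=1,\ldots,N}$ (Jacobi--Trudi); $\overline{K}_f$ is defined for all $f \in \mathrm{Sym}$ by linearity from $\overline{K}_{s_\lambda}=\overline{K}_\lambda$. Thus each of $U,D,K,\overline{K}$ is a linear map $f\mapsto P_f$ from $\mathrm{Sym}$ to $\operatorname{End}(\mathrm{Sym})$, and $P_\lambda:=P_{s_\lambda}$. For two linear maps $P,Q:\mathrm{Sym}\to\operatorname{End}(\mathrm{Sym})$, "finite expansions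 with respect to $(P,Q)$ are unique" means: for any $M\in\operatorname{End}(\mathrm{Sym})$ there is at most one finite expansion $M=\sum_{\alpha,\beta}a_{\alpha,\beta}P_\alpha Q_\beta$ (finitely many nonzero $a_{\alpha,\beta} \in \mathbb{Q}$, sum over pairs of partitions); equivalently, the family of operators $P_\alpha Q_\beta$ (composition), indexed by pairs of partitions $(\alpha,\beta)$, is linearly independent. *)

theory Defs
  imports "HOL-Library.Multiset" "Jordan_Normal_Form.Determinant"
begin

section \<open>The algebra Sym of symmetric functions over the rationals\<close>

text \<open>
  The variables are \<open>x\<^sub>0, x\<^sub>1, \<dots>\<close>; the monomial \<open>x\<^bsub>i1\<^esub> \<cdots> x\<^bsub>ik\<^esub>\<close> is encoded by the multiset
  \<open>{#i1, \<dots>, ik#}\<close> of variable indices, so that its degree is the size of the multiset and the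
  product of monomials is the sum of multisets.  A symmetric function is a formal power series
  of bounded degree, given by its coefficient function, that is invariant under all
  permutations of the variables.
\<close>

definition symmetric_function :: "(nat multiset \<Rightarrow> rat) \<Rightarrow> bool" where
  "symmetric_function f \<longleftrightarrow>
     (\<exists>d. \<forall>M. f M \<noteq> 0 \<longrightarrow> size M \<le> d) \<and>
     (\<forall>\<pi>. bij \<pi> \<longrightarrow> (\<forall>M. f (image_mset \<pi> M) = f M))"

typedef sym = "{f. symmetric_function f}"
  morphisms mcoeff Abs_sym
  by (rule exI[of _ "\<lambda>_. 0"]) (simp add: symmetric_function_def)

setup_lifting type_definition_sym

lemma symmetric_functionI:
  assumes "\<And>M. f M \<noteq> 0 \<Longrightarrow> size M \<le> d"
    and "\<And>\<pi> M. bij \<pi> \<Longrightarrow> f (image_mset \<pi> M) = f M"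
  shows "symmetric_function f"
  using assms unfolding symmetric_function_def by blast

lemma symmetric_function_bounded:
  "symmetric_function f \<Longrightarrow> \<exists>d. \<forall>M. f M \<noteq> 0 \<longrightarrow> size M \<le> d"
  by (simp add: symmetric_function_def)

lemma symmetric_function_perm:
  "symmetric_function f \<Longrightarrow> bij \<pi> \<Longrightarrow> f (image_mset \<pi> M) = f M"
  by (simp add: symmetric_function_def)

lemma finite_submultisets: "finite {A. A \<subseteq># (M :: 'a multiset)}"
proof (induction M)
  case (add x M)
  have "{A. A \<subseteq># add_mset x M} \<subseteq> {A. A \<subseteq># M} \<union> add_mset x ` {A. A \<subseteq># M}"
  proof
    fix A assume "A \<in> {A. A \<subseteq># add_mset x M}"
    then have A: "A \<subseteq># add_mset x M" by simp
    show "A \<in> {A. A \<subseteq># M} \<union> add_mset x ` {A. A \<subseteq># M}"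
    proof (cases "x \<in># A")
      case True
      then obtain B where B: "A = add_mset x B" by (metis multi_member_split)
      then show ?thesis using A by auto
    next
      case False
      then have "A \<subseteq># M"
        using A subset_eq_diff_conv[of A "{#x#}" M] by (simp add: diff_single_trivial)
      then show ?thesis by simp
    qed
  qed
  then show ?case by (rule finite_subset) (simp add: add)
qed simp

lemma submultisets_image:
  assumes "bij \<pi>"
  shows "{A. A \<subseteq># image_mset \<pi> M} = image_mset \<pi> ` {A. A \<subseteq># M}"
proof
  have id: "image_mset \<pi> (image_mset (inv_into UNIV \<pi>) A) = A" for A
    using assms by (simp add: multiset.map_comp surj_iff[THEN iffD1, OF bij_is_surj])
  have id': "image_mset (inv_into UNIV \<pi>) (image_mset \<pi> A) = A" for A
    using assms by (simp add: multiset.map_comp bij_is_inj)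
  show "{A. A \<subseteq># image_mset \<pi> M} \<subseteq> image_mset \<pi> ` {A. A \<subseteq># M}"
  proof
    fix A assume "A \<in> {A. A \<subseteq># image_mset \<pi> M}"
    then have "image_mset (inv_into UNIV \<pi>) A \<subseteq># M"
      using image_mset_subseteq_mono[of A "image_mset \<pi> M" "inv_into UNIV \<pi>"] by (simp add: id')
    then show "A \<in> image_mset \<pi> ` {A. A \<subseteq># M}"
      by (intro image_eqI[of _ _ "image_mset (inv_into UNIV \<pi>) A"]) (simp_all add: id)
  qed
qed (auto intro: image_mset_subseteq_mono)

definition mconv :: "(nat multiset \<Rightarrow> rat) \<Rightarrow> (nat multiset \<Rightarrow> rat) \<Rightarrow> nat multiset \<Rightarrow> rat" where
  "mconv f g M = (\<Sum>A | A \<subseteq># M. f A * g (M - A))"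

lemma mconv_comm: "mconv f g = mconv g f"
proof
  fix M
  show "mconv f g M = mconv g f M"
    unfolding mconv_def
    by (rule sum.reindex_bij_witness[of _ "\<lambda>A. M - A" "\<lambda>A. M - A"])
      (auto simp: subset_mset.diff_diff_right diff_subset_eq_self)
qed

lemma mconv_assoc: "mconv (mconv f g) h = mconv f (mconv g h)"
proof
  fix M
  have "mconv (mconv f g) h M =
      (\<Sum>(A, B) \<in> (SIGMA A:{A. A \<subseteq># M}. {B. B \<subseteq># A}). f B * g (A - B) * h (M - A))"
    by (simp add: mconv_def sum_distrib_right sum.Sigma finite_submultisets)
  also have "\<dots> = (\<Sum>(B, C) \<in> (SIGMA B:{B. B \<subseteq># M}. {C. C \<subseteq># M - B}).
      f B * (g C * h (M - B - C)))"
  proof (rule sum.reindex_bij_witness[of _ "\<lambda>(B, C). (B + C, B)" "\<lambda>(A, B). (B, A - B)"])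
    fix x assume "x \<in> (SIGMA A:{A. A \<subseteq># M}. {B. B \<subseteq># A})"
    then obtain A B where AB: "x = (A, B)" "A \<subseteq># M" "B \<subseteq># A" by blast
    then obtain C where "A = B + C" using subset_mset.le_iff_add by blast
    with AB have x: "x = (B + C, B)" and BC: "B + C \<subseteq># M" by simp_all
    have "B \<subseteq># M" using BC by (metis mset_subset_eq_add_left subset_mset.order_trans)
    moreover have "C \<subseteq># M - B"
      using BC \<open>B \<subseteq># M\<close> by (simp add: subset_mset.le_diff_conv2 add.commute)
    ultimately show "(case x of (A, B) \<Rightarrow> (B, A - B)) \<in> (SIGMA B:{B. B \<subseteq># M}. {C. C \<subseteq># M - B})"
      by (simp add: x)
    show "(case case x of (A, B) \<Rightarrow> (B, A - B) of (B, C) \<Rightarrow> (B + C, B)) = x"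
      by (simp add: x)
    show "(case case x of (A, B) \<Rightarrow> (B, A - B) of (B, C) \<Rightarrow> f B * (g C * h (M - B - C))) =
        (case x of (A, B) \<Rightarrow> f B * g (A - B) * h (M - A))"
      by (simp add: x mult.assoc)
  next
    fix y assume "y \<in> (SIGMA B:{B. B \<subseteq># M}. {C. C \<subseteq># M - B})"
    then obtain B C where y: "y = (B, C)" and "B \<subseteq># M" "C \<subseteq># M - B" by auto
    then have "B + C \<subseteq># M" by (simp add: subset_mset.le_diff_conv2 add.commute)
    then show "(case y of (B, C) \<Rightarrow> (B + C, B)) \<in> (SIGMA A:{A. A \<subseteq># M}. {B. B \<subseteq># A})"
      by (simp add: y)
    show "(case case y of (B, C) \<Rightarrow> (B + C, B) of (A, B) \<Rightarrow> (B, A - B)) = y"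
      by (simp add: y)
  qed
  also have "\<dots> = mconv f (mconv g h) M"
    by (simp add: mconv_def sum_distrib_left sum.Sigma finite_submultisets)
  finally show "mconv (mconv f g) h M = mconv f (mconv g h) M" .
qed

lemma symmetric_function_add:
  assumes "symmetric_function f" "symmetric_function g"
  shows "symmetric_function (\<lambda>M. f M + g M)"
proof -
  from symmetric_function_bounded[OF assms(1)]
  obtain d where f1: "\<forall>M. f M \<noteq> 0 \<longrightarrow> size M \<le> d" ..
  note f = f1[rule_format] symmetric_function_perm[OF assms(1)]
  from symmetric_function_bounded[OF assms(2)]
  obtain e where g1: "\<forall>M. g M \<noteq> 0 \<longrightarrow> size M \<le> e" ..
  note g = g1[rule_format] symmetric_function_perm[OF assms(2)]
  show ?thesis
  proof (rule symmetric_functionI)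
    fix M assume "f M + g M \<noteq> 0"
    then have "f M \<noteq> 0 \<or> g M \<noteq> 0" by auto
    then show "size M \<le> d + e" using f(1)[of M] g(1)[of M] by auto
  qed (simp add: f(2) g(2))
qed

lemma symmetric_function_cmult:
  assumes "symmetric_function f"
  shows "symmetric_function (\<lambda>M. c * f M)"
proof -
  from symmetric_function_bounded[OF assms]
  obtain d where f1: "\<forall>M. f M \<noteq> 0 \<longrightarrow> size M \<le> d" ..
  note f = f1[rule_format] symmetric_function_perm[OF assms]
  show ?thesis
    by (rule symmetric_functionI[of _ d]) (auto simp: f(2) intro: f(1))
qed

lemma symmetric_function_mconv:
  assumes "symmetric_function f" "symmetric_function g"
  shows "symmetric_function (mconv f g)"
proof -
  from symmetric_function_bounded[OF assms(1)]
  obtain d where f1: "\<forall>M. f M \<noteq> 0 \<longrightarrow> size M \<le> d" ..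
  note f = f1[rule_format] symmetric_function_perm[OF assms(1)]
  from symmetric_function_bounded[OF assms(2)]
  obtain e where g1: "\<forall>M. g M \<noteq> 0 \<longrightarrow> size M \<le> e" ..
  note g = g1[rule_format] symmetric_function_perm[OF assms(2)]
  show ?thesis
  proof (rule symmetric_functionI)
    fix M assume "mconv f g M \<noteq> 0"
    then obtain A where A: "A \<subseteq># M" "f A * g (M - A) \<noteq> 0"
      unfolding mconv_def by (metis (mono_tags, lifting) mem_Collect_eq sum.neutral)
    then have "size A \<le> d" "size (M - A) \<le> e" using f(1) g(1) by auto
    then show "size M \<le> d + e" using A(1) by (simp add: size_Diff_submset)
  next
    fix \<pi> :: "nat \<Rightarrow> nat" and M assume \<pi>: "bij \<pi>"
    have "inj (image_mset \<pi>)"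
      by (rule multiset.inj_map) (rule bij_is_inj[OF \<pi>])
    then have inj: "inj_on (image_mset \<pi>) X" for X
      by (rule inj_on_subset) simp
    have "mconv f g (image_mset \<pi> M) =
        (\<Sum>A | A \<subseteq># M. f (image_mset \<pi> A) * g (image_mset \<pi> M - image_mset \<pi> A))"
      unfolding mconv_def submultisets_image[OF \<pi>] by (simp add: sum.reindex[OF inj])
    also have "\<dots> = (\<Sum>A | A \<subseteq># M. f A * g (M - A))"
    proof (rule sum.cong[OF refl])
      fix A assume "A \<in> {A. A \<subseteq># M}"
      then have "image_mset \<pi> M - image_mset \<pi> A = image_mset \<pi> (M - A)"
        by (simp add: image_mset_Diff)
      then show "f (image_mset \<pi> A) * g (image_mset \<pi> M - image_mset \<pi> A) = f A * g (M - A)"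
        by (simp only: f(2)[OF \<pi>] g(2)[OF \<pi>])
    qed
    finally show "mconv f g (image_mset \<pi> M) = mconv f g M" by (simp only: mconv_def)
  qed
qed

lemma symmetric_function_psym:
  "symmetric_function (\<lambda>M. if \<exists>i. M = replicate_mset n i then 1 else 0)"
proof (rule symmetric_functionI[of _ n])
  fix \<pi> :: "nat \<Rightarrow> nat" and M assume \<pi>: "bij \<pi>"
  have "(\<exists>i. image_mset \<pi> M = replicate_mset n i) \<longleftrightarrow> (\<exists>i. M = replicate_mset n i)"
  proof
    assume "\<exists>i. image_mset \<pi> M = replicate_mset n i"
    then obtain i where "image_mset \<pi> M = replicate_mset n i" ..
    then have "image_mset \<pi> M = image_mset \<pi> (replicate_mset n (inv_into UNIV \<pi> i))"
      using \<pi> by (simp add: bij_is_surj surj_f_inv_f)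
    then have "M = replicate_mset n (inv_into UNIV \<pi> i)"
      by (rule injD[OF multiset.inj_map[OF bij_is_inj[OF \<pi>]]])
    then show "\<exists>i. M = replicate_mset n i" ..
  qed auto
  then show "(if \<exists>i. image_mset \<pi> M = replicate_mset n i then 1 else 0 :: rat) =
      (if \<exists>i. M = replicate_mset n i then 1 else 0)"
    by simp
qed (auto split: if_splits)

instantiation sym :: comm_ring_1
begin

lift_definition zero_sym :: sym is "\<lambda>_. 0"
  by (simp add: symmetric_function_def)

lift_definition one_sym :: sym is "\<lambda>M. if M = {#} then 1 else 0"
  by (rule symmetric_functionI[of _ 0]) (auto split: if_splits)

lift_definition plus_sym :: "sym \<Rightarrow> sym \<Rightarrow> sym" is "\<lambda>f g M. f M + g M"
  by (rule symmetric_function_add)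

lift_definition uminus_sym :: "sym \<Rightarrow> sym" is "\<lambda>f M. - f M"
proof -
  fix f assume "symmetric_function f"
  then have "symmetric_function (\<lambda>M. (- 1) * f M)" by (rule symmetric_function_cmult)
  then show "symmetric_function (\<lambda>M. - f M)" by simp
qed

definition minus_sym :: "sym \<Rightarrow> sym \<Rightarrow> sym" where "minus_sym f g = f + - g"

lift_definition times_sym :: "sym \<Rightarrow> sym \<Rightarrow> sym" is mconv
  by (rule symmetric_function_mconv)

instance
proof
  fix a b c :: sym
  show "a * b * c = a * (b * c)" by transfer (rule mconv_assoc)
  show "a * b = b * a" by transfer (rule mconv_comm)
  show "1 * a = a"
  proof transfer
    fix f :: "nat multiset \<Rightarrow> rat"
    show "mconv (\<lambda>M. if M = {#} then 1 else 0) f = f"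
    proof
      fix M
      have "mconv (\<lambda>M. if M = {#} then 1 else 0) f M = (\<Sum>A | A \<subseteq># M. if A = {#} then f M else 0)"
        unfolding mconv_def by (intro sum.cong) auto
      also have "\<dots> = f M" by (simp add: sum.delta finite_submultisets)
      finally show "mconv (\<lambda>M. if M = {#} then 1 else 0) f M = f M" .
    qed
  qed
  show "(a + b) * c = a * c + b * c"
    by transfer (auto simp: mconv_def fun_eq_iff distrib_right sum.distrib)
  show "a + b + c = a + (b + c)" by transfer (simp add: add.assoc)
  show "a + b = b + a" by transfer (simp add: add.commute)
  show "0 + a = a" by transfer simp
  show "- a + a = 0" by transfer simp
  show "a - b = a + - b" by (simp add: minus_sym_def)
  show "(0 :: sym) \<noteq> 1" by transfer (auto simp: fun_eq_iff)
qed

end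

lift_definition scale :: "rat \<Rightarrow> sym \<Rightarrow> sym" is "\<lambda>c f M. c * f M"
  by (rule symmetric_function_cmult)

global_interpretation sym: vector_space scale
proof
  fix a b :: rat and x y :: sym
  show "scale a (x + y) = scale a x + scale a y" by transfer (simp add: distrib_left)
  show "scale (a + b) x = scale a x + scale b x" by transfer (simp add: distrib_right)
  show "scale a (scale b x) = scale (a * b) x" by transfer (simp add: mult.assoc)
  show "scale 1 x = x" by transfer simp
qed

lift_definition hcomponent :: "nat \<Rightarrow> sym \<Rightarrow> sym" is "\<lambda>n f M. if size M = n then f M else 0"
proof -
  fix n f assume f: "symmetric_function f"
  show "symmetric_function (\<lambda>M. if size M = n then f M else 0)"
    by (rule symmetric_functionI[of _ n]) (simp_all add: symmetric_function_perm[OF f] split: if_splits)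
qed

section \<open>Complete homogeneous functions, power sums and Schur functions\<close>

lift_definition hsym :: "int \<Rightarrow> sym" is "\<lambda>n M. if int (size M) = n then 1 else 0"
proof -
  fix n
  show "symmetric_function (\<lambda>M. if int (size M) = n then 1 else 0)"
    by (rule symmetric_functionI[of _ "nat n"]) (auto split: if_splits)
qed

lemma hsym_0: "hsym 0 = 1"
  by transfer (simp add: fun_eq_iff)

lemma hsym_neg: "n < 0 \<Longrightarrow> hsym n = 0"
  by transfer (auto simp: fun_eq_iff)

lift_definition psym :: "nat \<Rightarrow> sym" is "\<lambda>n M. if \<exists>i. M = replicate_mset n i then 1 else 0"
  by (rule symmetric_function_psym)

definition partitions :: "nat list set" where
  "partitions = {\<mu>. sorted_wrt (\<ge>) \<mu> \<and> 0 \<notin> set \<mu>}"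

definition power_sum :: "nat list \<Rightarrow> sym" where
  "power_sum \<mu> = prod_list (map psym \<mu>)"

definition zee :: "nat list \<Rightarrow> nat" where
  "zee \<mu> = (\<Prod>i\<in>set \<mu>. i ^ count_list \<mu> i * fact (count_list \<mu> i))"

text \<open>The Jacobi--Trudi determinant of an arbitrary integer sequence.  Rows and columns are
  numbered from 0 here, which does not affect the difference \<open>j - i\<close>.\<close>

definition jacobi_trudi :: "int list \<Rightarrow> sym" where
  "jacobi_trudi \<alpha> =
     det (mat (length \<alpha>) (length \<alpha>) (\<lambda>(i, j). hsym (\<alpha> ! i + int j - int i)))"

definition schur :: "nat list \<Rightarrow> sym" where
  "schur \<mu> = jacobi_trudi (map int \<mu>)"

text \<open>Coordinates with respect to the Schur basis and to the power sum basis.  The library's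
  \<open>representation\<close> is total: it would return 0 on a set that is not linearly independent or for a
  vector outside its span, but both families are bases of Sym.\<close>

definition schur_coeff :: "sym \<Rightarrow> nat list \<Rightarrow> rat" where
  "schur_coeff f \<mu> = sym.representation (schur ` partitions) f (schur \<mu>)"

definition power_sum_coeff :: "sym \<Rightarrow> nat list \<Rightarrow> rat" where
  "power_sum_coeff f \<mu> = sym.representation (power_sum ` partitions) f (power_sum \<mu>)"

text \<open>The bilinear form for which the Schur functions are orthonormal.\<close>

definition hall :: "sym \<Rightarrow> sym \<Rightarrow> rat" where
  "hall f g = (\<Sum>\<mu> | \<mu> \<in> partitions \<and> schur_coeff f \<mu> \<noteq> 0. schur_coeff f \<mu> * schur_coeff g \<mu>)"

text \<open>The bilinear product with \<open>p\<^sub>\<mu> * p\<^sub>\<nu> = \<delta>\<^sub>\<mu>\<^sub>\<nu> z\<^sub>\<mu> p\<^sub>\<mu>\<close>.\<close>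

definition kronecker :: "sym \<Rightarrow> sym \<Rightarrow> sym" where
  "kronecker f g =
     (\<Sum>\<mu> | \<mu> \<in> partitions \<and> power_sum_coeff f \<mu> \<noteq> 0.
        scale (power_sum_coeff f \<mu> * power_sum_coeff g \<mu> * of_nat (zee \<mu>)) (power_sum \<mu>))"

section \<open>The operators\<close>

definition U_op :: "sym \<Rightarrow> sym \<Rightarrow> sym" where
  "U_op f g = f * g"

text \<open>The adjoint exists since, in each degree, there are only finitely many Schur functions, and
  it is unique because the Hall inner product is nondegenerate.\<close>

definition D_op :: "sym \<Rightarrow> sym \<Rightarrow> sym" where
  "D_op f = (THE D. \<forall>g h. hall (D g) h = hall g (U_op f h))"

definition K_op :: "sym \<Rightarrow> sym \<Rightarrow> sym" where
  "K_op f g = kronecker f g"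

text \<open>On each homogeneous component of degree \<open>n\<close>, the operator \<open>Kbar_part \<mu>\<close> is the Kronecker
  product by the Jacobi--Trudi determinant of \<open>(n - |\<mu>|, \<mu>\<^sub>1, \<mu>\<^sub>2, \<dots>)\<close>, whose first entry may be
  negative or smaller than \<open>\<mu>\<^sub>1\<close>.\<close>

definition Kbar_part :: "nat list \<Rightarrow> sym \<Rightarrow> sym" where
  "Kbar_part \<mu> g =
     (\<Sum>n | hcomponent n g \<noteq> 0.
        kronecker (jacobi_trudi ((int n - int (sum_list \<mu>)) # map int \<mu>)) (hcomponent n g))"

definition Kbar_op :: "sym \<Rightarrow> sym \<Rightarrow> sym" where
  "Kbar_op f g =
     (\<Sum>\<mu> | \<mu> \<in> partitions \<and> schur_coeff f \<mu> \<noteq> 0. scale (schur_coeff f \<mu>) (Kbar_part \<mu> g))"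

section \<open>Finite expansions\<close>

definition is_finite_expansion ::
    "(sym \<Rightarrow> sym \<Rightarrow> sym) \<Rightarrow> (sym \<Rightarrow> sym \<Rightarrow> sym) \<Rightarrow> (sym \<Rightarrow> sym) \<Rightarrow> (nat list \<times> nat list \<Rightarrow> rat) \<Rightarrow> bool"
  where
  "is_finite_expansion P Q M a \<longleftrightarrow>
     finite {x. a x \<noteq> 0} \<and> {x. a x \<noteq> 0} \<subseteq> partitions \<times> partitions \<and>
     (\<forall>g. M g = (\<Sum>(\<alpha>, \<beta>) | a (\<alpha>, \<beta>) \<noteq> 0. scale (a (\<alpha>, \<beta>)) (P (schur \<alpha>) (Q (schur \<beta>) g))))"

definition finite_expansions_unique :: "(sym \<Rightarrow> sym \<Rightarrow> sym) \<Rightarrow> (sym \<Rightarrow> sym \<Rightarrow> sym) \<Rightarrow> bool" where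
  "finite_expansions_unique P Q \<longleftrightarrow>
     (\<forall>M a b. Vector_Spaces.linear scale scale M \<longrightarrow>
        is_finite_expansion P Q M a \<longrightarrow> is_finite_expansion P Q M b \<longrightarrow> a = b)"

end

theory Submission
  imports Defs "HOL-Library.Multiset_Order" "HOL-Computational_Algebra.Formal_Power_Series"
begin

text \<open>
  Each of the six statements says that a family of composed operators is linearly independent.

  For \<open>(U, D)\<close>, a relation is applied to the Schur function of a partition \<open>\<gamma>\<close> of minimal size among
  the second indices in it.  For degree reasons and by orthonormality, \<open>D\<^sub>\<gamma>\<close> turns it into 1 and every
  other adjoint in the relation turns it into 0, which leaves a relation among Schur functions.

  For \<open>(D, U)\<close>, a relation says that an element \<open>\<Sum> s\<^sub>\<alpha> \<otimes> f\<^sub>\<alpha>\<close> of \<open>Sym \<otimes> Sym\<close> satisfies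
  \<open>\<Sum> \<langle>s\<^sub>\<alpha> g, f\<^sub>\<alpha> h\<rangle> = 0\<close> for all \<open>g\<close> and \<open>h\<close>.  The adjoint of multiplication by \<open>h\<^sub>n\<close> takes the
  coefficient of \<open>x\<^sub>0\<^sup>n\<close> (\<open>hall_hsym_mult\<close>), and the coefficient of a product is a sum of products of
  coefficients.  It follows that the property is inherited when every \<open>f\<^sub>\<alpha>\<close> is replaced by such a
  coefficient (\<open>annihilator_coeff0\<close>).  As this lowers the degree, an induction reduces the claim to
  constant \<open>f\<^sub>\<alpha>\<close>, where nondegeneracy of the inner product suffices (\<open>annihilator_trivial\<close>).

  Both \<open>K\<close> and \<open>Kbar\<close> are diagonal in the basis of the \<open>p\<^sub>\<mu>\<close>, with eigenvalues that are linearly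
  independent as functions of \<open>\<mu>\<close>; for \<open>Kbar\<close>, this holds because \<open>(n - |\<beta>|, \<beta>)\<close> is a
  partition for large \<open>n\<close>.  When a relation for \<open>(U, Q)\<close> with such a diagonal \<open>Q\<close> is applied to
  \<open>p\<^sub>\<mu>\<close>, it becomes the product of \<open>p\<^sub>\<mu>\<close> with a combination of Schur functions, which must vanish since
  \<open>Sym\<close> has no zero divisors (\<open>sym_no_zero_divisors\<close>).  For \<open>(Q, D)\<close>, the coordinate at \<open>p\<^sub>\<mu>\<close> of a
  relation has the form \<open>\<langle>q, D\<^sub>b g\<rangle> = \<langle>b q, g\<rangle>\<close> with a fixed nonzero \<open>q\<close>, and again \<open>b = 0\<close>.

  These arguments rest on two bases and on the adjoints just mentioned.  Products of power sums are
  a basis because they are triangular with respect to the number of variables in a monomial.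
  Pieri's rule, in a form with cancelling terms, comes from column operations on a determinant of
  power series (\<open>hsym_times_jt\<close>).  It shows that the Schur functions span, and being as many as the
  power sums in each degree, they are a basis as well.  The same rule and its counterpart for
  coefficients (\<open>coeff0_jt\<close>) give \<open>hall_hsym_mult\<close>, by comparing two sums over permutations.
\<close>

section \<open>Coefficients, grading and the absence of zero divisors\<close>

lemmas mcoeff_simps [simp] =
  zero_sym.rep_eq plus_sym.rep_eq uminus_sym.rep_eq scale.rep_eq hcomponent.rep_eq

lemma mcoeff_diff [simp]: "mcoeff (f - g) M = mcoeff f M - mcoeff g M"
  by (simp only: minus_sym_def plus_sym.rep_eq uminus_sym.rep_eq)

lemma mcoeff_sum [simp]: "mcoeff (sum f A) M = (\<Sum>x\<in>A. mcoeff (f x) M)"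
  by (induction A rule: infinite_finite_induct) auto

lemma sym_eqI: "(\<And>M. mcoeff f M = mcoeff g M) \<Longrightarrow> f = g"
  by (metis mcoeff_inject ext)

lemma mcoeff_times: "mcoeff (f * g) M = (\<Sum>A | A \<subseteq># M. mcoeff f A * mcoeff g (M - A))"
  by (simp add: times_sym.rep_eq mconv_def)

lemma mcoeff_times_nonzero:
  assumes "mcoeff (f * g) M \<noteq> 0"
  obtains A B where "M = A + B" "mcoeff f A \<noteq> 0" "mcoeff g B \<noteq> 0"
proof -
  from assms obtain A where A: "A \<subseteq># M" "mcoeff f A * mcoeff g (M - A) \<noteq> 0"
    unfolding mcoeff_times by (metis (mono_tags, lifting) mem_Collect_eq sum.neutral)
  show ?thesis using A by (intro that[of A "M - A"]) auto
qed

lemma mcoeff_perm: "bij \<pi> \<Longrightarrow> mcoeff f (image_mset \<pi> M) = mcoeff f M"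
  using mcoeff[of f] by (auto intro: symmetric_function_perm)

lemma mcoeff_bounded: obtains d where "\<And>M. mcoeff f M \<noteq> 0 \<Longrightarrow> size M \<le> d"
  using symmetric_function_bounded[of "mcoeff f"] mcoeff[of f] by auto

lemma scale_mult_left: "scale c f * g = scale c (f * g)"
  by (rule sym_eqI) (simp add: mcoeff_times sum_distrib_left mult.assoc)

lemma scale_mult_right: "f * scale c g = scale c (f * g)"
  by (simp add: mult.commute[of f] scale_mult_left)

lemma of_nat_times_eq_scale: "of_nat n * f = scale (of_nat n) f"
  by (induction n) (simp_all add: distrib_right sym.scale_left_distrib)

lemma of_int_times_eq_scale: "of_int k * f = scale (of_int k) f"
  by (cases k rule: int_diff_cases)
    (simp add: of_nat_times_eq_scale left_diff_distrib sym.scale_left_diff_distrib)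

text \<open>The multiset order is a well-order compatible with addition of exponents.  Hence the smallest
  monomial of a product is the sum of the smallest monomials of the factors, and its coefficient is
  the product of theirs.\<close>

lemma sym_no_zero_divisors:
  fixes f g :: sym
  assumes "f * g = 0"
  shows "f = 0 \<or> g = 0"
proof (rule ccontr)
  assume "\<not> (f = 0 \<or> g = 0)"
  then obtain A0 B0 where "mcoeff f A0 \<noteq> 0" "mcoeff g B0 \<noteq> 0"
    by (metis sym_eqI zero_sym.rep_eq)
  define A where "A = (LEAST A. mcoeff f A \<noteq> 0)"
  define B where "B = (LEAST B. mcoeff g B \<noteq> 0)"
  have A: "mcoeff f A \<noteq> 0" and Amin: "\<And>A'. mcoeff f A' \<noteq> 0 \<Longrightarrow> A \<le> A'"
    unfolding A_def by (rule LeastI, fact) (rule Least_le)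
  have B: "mcoeff g B \<noteq> 0" and Bmin: "\<And>B'. mcoeff g B' \<noteq> 0 \<Longrightarrow> B \<le> B'"
    unfolding B_def by (rule LeastI, fact) (rule Least_le)
  have "mcoeff f A' * mcoeff g (A + B - A') = 0" if "A' \<subseteq># A + B" "A' \<noteq> A" for A'
  proof (rule ccontr)
    assume "mcoeff f A' * mcoeff g (A + B - A') \<noteq> 0"
    then have "A \<le> A'" "B \<le> A + B - A'" using Amin Bmin by auto
    with that(2) have "A + B < A' + (A + B - A')" by (intro add_less_le_mono) auto
    then show False using that(1) by simp
  qed
  then have "mcoeff (f * g) (A + B) = (\<Sum>A' | A' \<subseteq># A + B. if A' = A then mcoeff f A * mcoeff g B else 0)"
    unfolding mcoeff_times by (intro sum.cong) auto
  also have "\<dots> = mcoeff f A * mcoeff g B"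
    by (simp add: sum.delta finite_submultisets)
  finally show False using A B assms by simp
qed

definition homogeneous :: "nat \<Rightarrow> sym \<Rightarrow> bool" where
  "homogeneous n f \<longleftrightarrow> (\<forall>M. mcoeff f M \<noteq> 0 \<longrightarrow> size M = n)"

lemma homogeneousD: "homogeneous n f \<Longrightarrow> mcoeff f M \<noteq> 0 \<Longrightarrow> size M = n"
  by (simp add: homogeneous_def)

lemma homogeneous_0 [simp]: "homogeneous n 0"
  by (simp add: homogeneous_def)

lemma homogeneous_1 [simp]: "homogeneous 0 1"
  by (simp add: homogeneous_def one_sym.rep_eq)

lemma homogeneous_scale: "homogeneous n f \<Longrightarrow> homogeneous n (scale c f)"
  by (simp add: homogeneous_def)

lemma homogeneous_add: "homogeneous n f \<Longrightarrow> homogeneous n g \<Longrightarrow> homogeneous n (f + g)"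
  unfolding homogeneous_def plus_sym.rep_eq by (metis add.right_neutral)

lemma homogeneous_sum: "(\<And>x. x \<in> A \<Longrightarrow> homogeneous n (f x)) \<Longrightarrow> homogeneous n (sum f A)"
  by (induction A rule: infinite_finite_induct) (auto intro: homogeneous_add)

lemma homogeneous_mult: "homogeneous m f \<Longrightarrow> homogeneous n g \<Longrightarrow> homogeneous (m + n) (f * g)"
  unfolding homogeneous_def by (metis mcoeff_times_nonzero size_union)

lemma homogeneous_hsym: "homogeneous n (hsym (int n))"
  by (simp add: homogeneous_def hsym.rep_eq)

lemma homogeneous_psym: "homogeneous n (psym n)"
  by (auto simp: homogeneous_def psym.rep_eq split: if_splits)

lemma homogeneous_hcomponent [simp]: "homogeneous n (hcomponent n f)"
  by (simp add: homogeneous_def)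

lemma hcomponent_homogeneous: "homogeneous n f \<Longrightarrow> hcomponent n f = f"
  by (rule sym_eqI) (auto simp: homogeneous_def)

lemma hcomponent_homogeneous_other: "homogeneous n f \<Longrightarrow> m \<noteq> n \<Longrightarrow> hcomponent m f = 0"
  by (rule sym_eqI) (auto simp: homogeneous_def)

lemma hcomponents_sum:
  assumes "\<And>M. mcoeff f M \<noteq> 0 \<Longrightarrow> size M \<le> d"
  shows "f = (\<Sum>n\<le>d. hcomponent n f)"
proof (rule sym_eqI)
  fix M
  have "mcoeff (\<Sum>n\<le>d. hcomponent n f) M = (if size M \<le> d then mcoeff f M else 0)"
    by simp
  then show "mcoeff f M = mcoeff (\<Sum>n\<le>d. hcomponent n f) M" using assms[of M] by auto
qed

lemma finite_hcomponents: "finite {n. hcomponent n f \<noteq> 0}"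
proof -
  obtain d where d: "\<And>M. mcoeff f M \<noteq> 0 \<Longrightarrow> size M \<le> d" using mcoeff_bounded by blast
  have "{n. hcomponent n f \<noteq> 0} \<subseteq> {..d}"
  proof safe
    fix n assume "hcomponent n f \<noteq> 0"
    then obtain M where "mcoeff (hcomponent n f) M \<noteq> mcoeff 0 M" using sym_eqI by blast
    then show "n \<le> d" using d[of M] by (auto split: if_splits)
  qed
  then show ?thesis by (rule finite_subset) simp
qed

section \<open>Power sums form a basis\<close>

text \<open>A permutation of the variables takes \<open>M\<close> to \<open>M'\<close> if and only if both have the same exponents, so
  that these stand for the orbit of a monomial.\<close>

definition exponents :: "nat multiset \<Rightarrow> nat multiset" where
  "exponents M = image_mset (count M) (mset_set (set_mset M))"

lemma zero_notin_exponents: "0 \<notin># exponents M"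
  by (force simp: exponents_def simp flip: count_greater_zero_iff)

lemma size_exponents: "size (exponents M) = card (set_mset M)"
  by (simp add: exponents_def)

lemma sum_exponents: "sum_mset (exponents M) = size M"
  by (simp only: exponents_def size_multiset_overloaded_eq sum_unfold_sum_mset)

lemma exponents_add_replicate:
  assumes "a > 0" "x \<notin># M"
  shows "exponents (M + replicate_mset a x) = add_mset a (exponents M)"
proof -
  have "set_mset (M + replicate_mset a x) = insert x (set_mset M)" using assms by auto
  moreover have "image_mset (count (M + replicate_mset a x)) (mset_set (set_mset M)) =
      image_mset (count M) (mset_set (set_mset M))"
    using assms(2) by (intro image_mset_cong) auto
  ultimately show ?thesis using assms by (simp add: exponents_def count_eq_zero_iff)
qed

lemma exponents_surj: "0 \<notin># A \<Longrightarrow> \<exists>M. exponents M = A"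
proof (induction A)
  case (add a A)
  then obtain M where M: "exponents M = A" by auto
  obtain x :: nat where "x \<notin># M"
    using ex_new_if_finite[OF infinite_UNIV_nat, of "set_mset M"] by auto
  then show ?case using exponents_add_replicate[of a x M] M add.prems by auto
qed (auto intro: exI[of _ "{#}"] simp: exponents_def)

lemma bij_extends:
  assumes f: "bij_betw f A B" and fin: "finite A"
  obtains g :: "'a \<Rightarrow> 'a" where "bij g" "\<And>x. x \<in> A \<Longrightarrow> g x = f x"
proof -
  let ?C = "A \<union> B"
  have fB: "finite B" using f fin bij_betw_finite by auto
  have "card A = card B" using f by (rule bij_betw_same_card)
  then have "card (?C - A) = card (?C - B)"
    using fin fB by (simp add: card_Diff_subset)
  then obtain h where h: "bij_betw h (?C - A) (?C - B)"
    using fin fB finite_same_card_bij by (metis finite_Diff finite_UnI)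
  define g where "g x = (if x \<in> A then f x else if x \<in> B then h x else x)" for x
  have 1: "bij_betw g A B" using f by (rule bij_betw_cong[THEN iffD1, rotated]) (simp add: g_def)
  have 2: "bij_betw g (?C - A) (?C - B)"
    using h by (rule bij_betw_cong[THEN iffD1, rotated]) (auto simp: g_def)
  have 3: "bij_betw g (- ?C) (- ?C)"
    using bij_betw_id by (rule bij_betw_cong[THEN iffD1, rotated]) (auto simp: g_def)
  have "bij_betw g (A \<union> (?C - A)) (B \<union> (?C - B))" by (rule bij_betw_combine[OF 1 2]) auto
  then have "bij_betw g (A \<union> (?C - A) \<union> - ?C) (B \<union> (?C - B) \<union> - ?C)"
    by (rule bij_betw_combine[OF _ 3]) auto
  moreover have "A \<union> (?C - A) \<union> - ?C = UNIV" "B \<union> (?C - B) \<union> - ?C = UNIV" by auto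
  ultimately have "bij g" by simp
  then show ?thesis by (rule that) (simp add: g_def)
qed

lemma image_mset_eq_bij:
  assumes "finite A" "finite B" "image_mset f (mset_set A) = image_mset g (mset_set B)"
  shows "\<exists>h. bij_betw h A B \<and> (\<forall>x\<in>A. g (h x) = f x)"
  using assms
proof (induction A arbitrary: B rule: finite_induct)
  case empty
  then have "B = {}" by (simp add: mset_set_empty_iff)
  then show ?case by (simp add: bij_betw_def)
next
  case (insert a A)
  then have eq: "add_mset (f a) (image_mset f (mset_set A)) = image_mset g (mset_set B)" by simp
  then have "f a \<in># image_mset g (mset_set B)" by (metis union_single_eq_member)
  then obtain b where b: "b \<in> B" "f a = g b" using insert.prems by auto
  have "mset_set B = add_mset b (mset_set (B - {b}))"
    using b insert.prems by (simp add: mset_set.remove)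
  with eq b have "image_mset f (mset_set A) = image_mset g (mset_set (B - {b}))" by simp
  with insert.IH[of "B - {b}"] insert.prems obtain h
    where h: "bij_betw h A (B - {b})" "\<forall>x\<in>A. g (h x) = f x" by auto
  have "bij_betw (h(a := b)) A (B - {b})"
    using h(1) by (rule bij_betw_cong[THEN iffD1, rotated]) (use insert.hyps in auto)
  then have "bij_betw (h(a := b)) (insert a A) (insert b (B - {b}))"
    using insert.hyps notIn_Un_bij_betw[of a A "h(a := b)" "B - {b}"] by simp
  moreover have "insert b (B - {b}) = B" using b by auto
  moreover have "\<forall>x\<in>insert a A. g ((h(a := b)) x) = f x" using h(2) b insert.hyps by auto
  ultimately show ?case by metis
qed

lemma same_exponents_bij:
  assumes "exponents M = exponents M'"
  obtains \<pi> where "bij \<pi>" "M' = image_mset \<pi> M"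
proof -
  have "\<exists>f. bij_betw f (set_mset M) (set_mset M') \<and> (\<forall>x\<in>set_mset M. count M x = count M' (f x))"
    using image_mset_eq_bij[of "set_mset M" "set_mset M'" "count M" "count M'"] assms
    by (simp add: exponents_def) metis
  then obtain f where f: "bij_betw f (set_mset M) (set_mset M')"
    and c: "\<And>x. x \<in># M \<Longrightarrow> count M' (f x) = count M x" by auto
  obtain g where g: "bij g" "\<And>x. x \<in> set_mset M \<Longrightarrow> g x = f x"
    using bij_extends[OF f] by auto
  have "M' = image_mset g M"
  proof (rule multiset_eqI)
    fix y
    obtain x where y: "y = g x" using g(1) by (metis bij_pointE)
    have cnt: "count (image_mset g M) (g x) = count M x"
      using g(1) by (induction M) (auto simp: bij_def inj_eq)
    show "count M' y = count (image_mset g M) y"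
    proof (cases "x \<in># M")
      case True then show ?thesis using cnt c g(2) y by simp
    next
      case False
      have "g x \<notin># M'"
      proof
        assume "g x \<in># M'"
        then obtain x' where "x' \<in># M" "g x = f x'" using f by (auto simp: bij_betw_def)
        then have "g x = g x'" using g(2) by simp
        then have "x = x'" using g(1) by (simp add: bij_def inj_eq)
        then show False using False \<open>x' \<in># M\<close> by simp
      qed
      then show ?thesis using cnt y False by (simp add: not_in_iff)
    qed
  qed
  then show ?thesis using g(1) that by blast
qed

lemma mcoeff_exponents: "exponents M = exponents M' \<Longrightarrow> mcoeff f M = mcoeff f M'"
  by (metis same_exponents_bij mcoeff_perm)

text \<open>Indexing by multisets instead of sorted lists lets a factor be added without sorting.\<close>

definition psums :: "nat multiset \<Rightarrow> sym" where
  "psums A = prod_mset (image_mset psym A)"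

lemma mcoeff_psym_times:
  assumes "a > 0"
  shows "mcoeff (psym a * f) M = (\<Sum>x | a \<le> count M x. mcoeff f (M - replicate_mset a x))"
proof -
  have "mcoeff (psym a * f) M =
      (\<Sum>A | A \<subseteq># M. if \<exists>i. A = replicate_mset a i then mcoeff f (M - A) else 0)"
    unfolding mcoeff_times by (intro sum.cong) (auto simp: psym.rep_eq)
  also have "\<dots> = (\<Sum>A \<in> {A. A \<subseteq># M} \<inter> {A. \<exists>i. A = replicate_mset a i}. mcoeff f (M - A))"
    by (simp add: sum.inter_restrict finite_submultisets)
  also have "{A. A \<subseteq># M} \<inter> {A. \<exists>i. A = replicate_mset a i} = replicate_mset a ` {x. a \<le> count M x}"
    by (auto simp: count_le_replicate_mset_subset_eq)
  also have "(\<Sum>A\<in>\<dots>. mcoeff f (M - A)) = (\<Sum>x | a \<le> count M x. mcoeff f (M - replicate_mset a x))"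
  proof (subst sum.reindex)
    show "inj_on (replicate_mset a) {x. a \<le> count M x}"
    proof (rule inj_onI)
      fix x y assume "replicate_mset a x = replicate_mset a y"
      then have "set_mset (replicate_mset a x) = set_mset (replicate_mset a y)" by simp
      then show "x = y" using assms by simp
    qed
  qed simp
  finally show ?thesis .
qed

lemma psums_empty [simp]: "psums {#} = 1"
  and psums_add_mset [simp]: "psums (add_mset a A) = psym a * psums A"
  by (simp_all add: psums_def)

lemma homogeneous_psums: "homogeneous (sum_mset A) (psums A)"
  by (induction A) (auto intro: homogeneous_mult homogeneous_psym)

lemma power_sum_psums: "power_sum \<mu> = psums (mset \<mu>)"
  by (induction \<mu>) (simp_all add: power_sum_def psums_def)

lemma mcoeff_psums_nonneg: "0 \<notin># A \<Longrightarrow> mcoeff (psums A) M \<ge> 0"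
  by (induction A arbitrary: M) (simp_all add: one_sym.rep_eq mcoeff_psym_times sum_nonneg)

text \<open>Multiplying out a product of power sums, every factor \<open>p\<^sub>a\<close> contributes the \<open>a\<close>-th power of one
  variable.  The variables chosen for different factors may coincide, but a monomial with as many
  variables as there are factors arises only when they are all different.\<close>

lemma mcoeff_psums_nonzero:
  assumes "0 \<notin># A" "mcoeff (psums A) M \<noteq> 0"
  shows "size (exponents M) \<le> size A \<and> (size (exponents M) = size A \<longrightarrow> exponents M = A)"
  using assms
proof (induction A arbitrary: M)
  case empty
  then show ?case by (auto simp: one_sym.rep_eq exponents_def split: if_splits)
next
  case (add a A)
  then have a: "a > 0" by auto
  from add.prems have "(\<Sum>x | a \<le> count M x. mcoeff (psums A) (M - replicate_mset a x)) \<noteq> 0"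
    using a by (simp add: mcoeff_psym_times)
  then obtain x where x: "a \<le> count M x" "mcoeff (psums A) (M - replicate_mset a x) \<noteq> 0"
    by (metis (mono_tags, lifting) mem_Collect_eq sum.neutral)
  define M' where "M' = M - replicate_mset a x"
  have M: "M = M' + replicate_mset a x"
    using x(1) by (simp add: M'_def count_le_replicate_mset_subset_eq)
  have IH: "size (exponents M') \<le> size A" "size (exponents M') = size A \<longrightarrow> exponents M' = A"
    using add.IH[of M'] add.prems x(2) by (auto simp: M'_def)
  show ?case
  proof (cases "x \<in># M'")
    case True
    then have "set_mset M = set_mset M'" by (auto simp: M)
    then show ?thesis using IH by (simp add: size_exponents)
  next
    case False
    then have "exponents M = add_mset a (exponents M')"
      unfolding M using a by (rule exponents_add_replicate[rotated])
    then show ?thesis using IH by simp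
  qed
qed

lemma mcoeff_psums_exponents:
  assumes "exponents M = A"
  shows "mcoeff (psums A) M > 0"
proof -
  have "0 \<notin># A" using assms zero_notin_exponents by blast
  then have "\<exists>M. exponents M = A \<and> mcoeff (psums A) M > 0"
  proof (induction A)
    case empty
    show ?case by (intro exI[of _ "{#}"]) (simp add: exponents_def one_sym.rep_eq)
  next
    case (add a A)
    then obtain M where M: "exponents M = A" "mcoeff (psums A) M > 0" by auto
    obtain x :: nat where x: "x \<notin># M"
      using ex_new_if_finite[OF infinite_UNIV_nat, of "set_mset M"] by auto
    let ?M = "M + replicate_mset a x"
    have a: "a > 0" using add.prems by auto
    have "mcoeff (psums A) M = mcoeff (psums A) (?M - replicate_mset a x)" by simp
    also have "\<dots> \<le> (\<Sum>y | a \<le> count ?M y. mcoeff (psums A) (?M - replicate_mset a y))"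
    proof (rule member_le_sum)
      have "{y. a \<le> count ?M y} \<subseteq> set_mset ?M"
        using a by (auto simp: count_greater_zero_iff[symmetric] simp del: count_greater_zero_iff)
      then show "finite {y. a \<le> count ?M y}" by (rule finite_subset) simp
    qed (use add.prems in \<open>auto intro: mcoeff_psums_nonneg\<close>)
    also have "\<dots> = mcoeff (psums (add_mset a A)) ?M" using a by (simp add: mcoeff_psym_times)
    finally show ?case
      using M exponents_add_replicate[OF a x] by (intro exI[of _ ?M]) auto
  qed
  then show ?thesis using assms mcoeff_exponents by metis
qed

definition part_msets :: "nat \<Rightarrow> nat multiset set" where
  "part_msets n = {A. 0 \<notin># A \<and> sum_mset A = n}"

text \<open>Let \<open>B\<close> be a longest index with nonzero coefficient.  At a monomial with exponents \<open>B\<close>, no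
  other term of the relation contributes.\<close>

lemma psums_relation_trivial:
  assumes fin: "finite S" and S: "\<And>A. A \<in> S \<Longrightarrow> 0 \<notin># A"
    and rel: "(\<Sum>A\<in>S. scale (c A) (psums A)) = 0" and "A \<in> S"
  shows "c A = 0"
proof (rule ccontr)
  let ?T = "{A \<in> S. c A \<noteq> 0}"
  assume "c A \<noteq> 0"
  then have "?T \<noteq> {}" "finite ?T" using assms by auto
  then obtain B where B: "B \<in> ?T" and Bmax: "\<And>C. C \<in> ?T \<Longrightarrow> size C \<le> size B"
  proof -
    have "Max (size ` ?T) \<in> size ` ?T"
      using \<open>?T \<noteq> {}\<close> \<open>finite ?T\<close> by (intro Max_in) auto
    then obtain B where "B \<in> ?T" "size B = Max (size ` ?T)" by auto
    then show ?thesis using \<open>finite ?T\<close> by (intro that[of B]) auto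
  qed
  obtain M where M: "exponents M = B" using exponents_surj S B by blast
  have "c C * mcoeff (psums C) M = 0" if "C \<in> S - {B}" for C
  proof (rule ccontr)
    assume n: "c C * mcoeff (psums C) M \<noteq> 0"
    then have "size C \<le> size B" using Bmax that by auto
    with mcoeff_psums_nonzero[of C M] n S that M show False by auto
  qed
  then have "mcoeff (\<Sum>A\<in>S. scale (c A) (psums A)) M = c B * mcoeff (psums B) M"
  proof -
    have "(\<Sum>C\<in>S - {B}. c C * mcoeff (psums C) M) = 0"
      by (intro sum.neutral ballI) (rule \<open>\<And>C. C \<in> S - {B} \<Longrightarrow> c C * mcoeff (psums C) M = 0\<close>)
    then show ?thesis using fin B by (simp add: sum.remove[of S B])
  qed
  then show False using rel B mcoeff_psums_exponents[OF M] by simp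
qed

lemma finite_part_msets: "finite (part_msets n)"
proof -
  have "part_msets n \<subseteq> mset ` {xs. set xs \<subseteq> {..n} \<and> length xs \<le> n}"
  proof
    fix A assume A: "A \<in> part_msets n"
    obtain xs where xs: "A = mset xs" by (metis ex_mset)
    have len: "0 \<notin># B \<Longrightarrow> size B \<le> sum_mset B" for B :: "nat multiset" by (induction B) auto
    have "set xs \<subseteq> {..n}"
      using A by (auto simp: xs part_msets_def sum_mset_sum_list intro: member_le_sum_list)
    then show "A \<in> mset ` {xs. set xs \<subseteq> {..n} \<and> length xs \<le> n}"
      using A len[of A] by (auto simp: xs part_msets_def)
  qed
  then show ?thesis by (rule finite_subset) (simp add: finite_lists_length_le)
qed

text \<open>Subtracting the power sums of the longest exponents occurring in \<open>f\<close>, with suitable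
  coefficients, leaves monomials in fewer variables.\<close>

lemma psums_span:
  assumes "homogeneous n f"
  shows "f \<in> sym.span (psums ` part_msets n)"
proof -
  have "f \<in> sym.span (psums ` part_msets n)"
    if "homogeneous n f" "\<And>M. mcoeff f M \<noteq> 0 \<Longrightarrow> size (exponents M) < k" for f k
    using that
  proof (induction k arbitrary: f)
    case 0
    then have "f = 0" by (intro sym_eqI) auto
    then show ?case by (simp add: sym.span_zero)
  next
    case (Suc k)
    define m where "m A = (SOME M. exponents M = A)" for A
    have m: "exponents (m A) = A" if "0 \<notin># A" for A
      unfolding m_def using exponents_surj[OF that] by (rule someI_ex)
    define S where "S = {A \<in> part_msets n. size A = k}"
    define g where "g = (\<Sum>A\<in>S. scale (mcoeff f (m A) / mcoeff (psums A) (m A)) (psums A))"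
    have fin: "finite S" using finite_part_msets by (simp add: S_def)
    have "g \<in> sym.span (psums ` part_msets n)"
      unfolding g_def by (intro sym.span_sum sym.span_scale sym.span_base) (auto simp: S_def)
    moreover have "f - g \<in> sym.span (psums ` part_msets n)"
    proof (rule Suc.IH)
      have hg: "homogeneous n g"
        unfolding g_def S_def part_msets_def
        by (intro homogeneous_sum homogeneous_scale) (auto intro: homogeneous_psums)
      then show hfg: "homogeneous n (f - g)"
        using homogeneous_add[OF Suc.prems(1) homogeneous_scale[of n g "-1"]]
        by (simp add: sym.scale_minus_left)
      fix M assume M: "mcoeff (f - g) M \<noteq> 0"
      have size: "size (exponents M) \<le> k"
      proof (cases "mcoeff f M = 0")
        case True
        then have "mcoeff g M \<noteq> 0" using M by simp
        then obtain A where "A \<in> S" "mcoeff (psums A) M \<noteq> 0"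
          unfolding g_def by (auto elim: sum.not_neutral_contains_not_neutral)
        then show ?thesis using mcoeff_psums_nonzero[of A M] by (auto simp: S_def part_msets_def)
      next
        case False
        then show ?thesis using Suc.prems(2)[of M] by simp
      qed
      moreover have "size (exponents M) \<noteq> k"
      proof
        assume k: "size (exponents M) = k"
        let ?A = "exponents M"
        have A: "?A \<in> S"
          using k homogeneousD[OF hfg M] by (simp add: S_def part_msets_def zero_notin_exponents sum_exponents)
        have "mcoeff (psums B) M = 0" if "B \<in> S - {?A}" for B
          using that mcoeff_psums_nonzero[of B M] k by (auto simp: S_def part_msets_def)
        then have "mcoeff g M = mcoeff f (m ?A) / mcoeff (psums ?A) (m ?A) * mcoeff (psums ?A) M"
          unfolding g_def using fin A by (simp add: sum.remove[of S ?A])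
        also have "mcoeff (psums ?A) (m ?A) = mcoeff (psums ?A) M"
          by (intro mcoeff_exponents m zero_notin_exponents)
        also have "mcoeff f (m ?A) = mcoeff f M"
          by (intro mcoeff_exponents m zero_notin_exponents)
        finally have "mcoeff g M = mcoeff f M" using mcoeff_psums_exponents[OF refl, of M] by simp
        then show False using M by simp
      qed
      ultimately show "size (exponents M) < k" by simp
    qed
    ultimately show ?case using sym.span_add by fastforce
  qed
  moreover have "size (exponents M) < Suc n" if "mcoeff f M \<noteq> 0" for M
  proof -
    have "card (set_mset M) \<le> size M"
      by (metis size_mset_set finite_set_mset mset_set_set_mset_msubset size_mset_mono)
    then show ?thesis using homogeneousD[OF assms that] by (simp add: size_exponents)
  qed
  ultimately show ?thesis using assms by blast
qed

section \<open>The complete homogeneous functions\<close>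

lemma mcoeff_hsym: "mcoeff (hsym m) M = (if int (size M) = m then 1 else 0)"
  by (simp add: hsym.rep_eq)

lemma sum_card_count_ge: "(\<Sum>i=1..size M. card {x. i \<le> count M x}) = size M"
proof -
  have "(\<Sum>i=1..size M. card {x. i \<le> count M x}) =
      (\<Sum>i=1..size M. \<Sum>x\<in>set_mset M. if i \<le> count M x then 1 else 0)"
  proof (rule sum.cong[OF refl])
    fix i assume "i \<in> {1..size M}"
    then have "{x. i \<le> count M x} = {x \<in> set_mset M. i \<le> count M x}"
      by (auto simp flip: count_greater_zero_iff)
    then show "card {x. i \<le> count M x} = (\<Sum>x\<in>set_mset M. if i \<le> count M x then 1 else 0)"
      by (simp add: sum.If_cases Int_def)
  qed
  also have "\<dots> = (\<Sum>x\<in>set_mset M. \<Sum>i=1..size M. if i \<le> count M x then 1 else 0)"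
    by (rule sum.swap)
  also have "\<dots> = (\<Sum>x\<in>set_mset M. count M x)"
  proof (rule sum.cong[OF refl])
    fix x
    have "count M x \<le> size M" by (rule count_le_size)
    then have "{1..size M} \<inter> {i. i \<le> count M x} = {1..count M x}" by auto
    then show "(\<Sum>i=1..size M. if i \<le> count M x then 1 else 0) = count M x"
      by (simp add: sum.If_cases)
  qed
  also have "\<dots> = size M" by (simp add: size_multiset_overloaded_eq)
  finally show ?thesis .
qed

text \<open>Newton's identity.  On the right, a monomial \<open>M\<close> of degree \<open>n\<close> is counted once for each variable
  \<open>x\<close> and each \<open>i\<close> from 1 to its exponent, that is, \<open>n\<close> times.\<close>

lemma newton_identity: "of_nat n * hsym (int n) = (\<Sum>i=1..n. psym i * hsym (int (n - i)))"
proof (rule sym_eqI)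
  fix M :: "nat multiset"
  have fin: "finite {x. i \<le> count M x}" if "i \<ge> 1" for i
    using that by (intro finite_subset[OF _ finite_set_mset[of M]]) (auto simp flip: count_greater_zero_iff)
  have size: "size (M - replicate_mset i x) = size M - i" "i \<le> size M" if "i \<le> count M x" for i x
    using that count_le_size[of M x] size_Diff_submset[of "replicate_mset i x" M]
    by (simp_all add: count_le_replicate_mset_subset_eq[THEN iffD1])
  have "mcoeff (\<Sum>i=1..n. psym i * hsym (int (n - i))) M =
      (\<Sum>i=1..n. \<Sum>x | i \<le> count M x. if size M = n then 1 else 0)"
    unfolding mcoeff_sum
  proof (rule sum.cong[OF refl])
    fix i assume i: "i \<in> {1..n}"
    then have "mcoeff (psym i * hsym (int (n - i))) M =
        (\<Sum>x | i \<le> count M x. mcoeff (hsym (int (n - i))) (M - replicate_mset i x))"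
      by (simp add: mcoeff_psym_times)
    also have "\<dots> = (\<Sum>x | i \<le> count M x. if size M = n then 1 else 0)"
      by (rule sum.cong) (use i size in \<open>fastforce simp: mcoeff_hsym\<close>)+
    finally show "mcoeff (psym i * hsym (int (n - i))) M = \<dots>" .
  qed
  also have "\<dots> = (if size M = n then of_nat (\<Sum>i=1..size M. card {x. i \<le> count M x}) else 0)"
    by simp
  also have "\<dots> = mcoeff (of_nat n * hsym (int n)) M"
    unfolding sum_card_count_ge by (simp add: of_nat_times_eq_scale mcoeff_hsym)
  finally show "mcoeff (of_nat n * hsym (int n)) M = mcoeff (\<Sum>i=1..n. psym i * hsym (int (n - i))) M" ..
qed

text \<open>The coefficient of \<open>x\<^sub>0\<^sup>n\<close>, as a symmetric function of the variables \<open>x\<^sub>1, x\<^sub>2, \<dots>\<close>, which are then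
  renamed to \<open>x\<^sub>0, x\<^sub>1, \<dots>\<close>.\<close>

lift_definition coeff0 :: "nat \<Rightarrow> sym \<Rightarrow> sym" is
  "\<lambda>n f M. f (image_mset Suc M + replicate_mset n 0)"
proof -
  fix n f assume f: "symmetric_function f"
  from symmetric_function_bounded[OF f] obtain d where d: "\<forall>M. f M \<noteq> 0 \<longrightarrow> size M \<le> d" ..
  show "symmetric_function (\<lambda>M. f (image_mset Suc M + replicate_mset n 0))"
  proof (rule symmetric_functionI[of _ d])
    fix M assume "f (image_mset Suc M + replicate_mset n 0) \<noteq> 0"
    then have "size (image_mset Suc M + replicate_mset n 0) \<le> d" using d by blast
    then show "size M \<le> d" by simp
  next
    fix \<pi> :: "nat \<Rightarrow> nat" and M assume \<pi>: "bij \<pi>"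
    define \<rho> where "\<rho> k = (case k of 0 \<Rightarrow> 0 | Suc k \<Rightarrow> Suc (\<pi> k))" for k
    have "bij \<rho>"
    proof (rule bijI)
      show "inj \<rho>"
      proof (rule injI)
        fix x y assume "\<rho> x = \<rho> y"
        then show "x = y" using injD[OF bij_is_inj[OF \<pi>]]
          by (cases x; cases y) (auto simp: \<rho>_def)
      qed
      have "\<exists>k. y = \<rho> k" for y
      proof (cases y)
        case 0 then show ?thesis by (intro exI[of _ 0]) (simp add: \<rho>_def)
      next
        case (Suc z)
        obtain k where "z = \<pi> k" using \<pi> by (metis bij_pointE)
        then show ?thesis using Suc by (intro exI[of _ "Suc k"]) (simp add: \<rho>_def)
      qed
      then show "surj \<rho>" by auto
    qed
    moreover have "image_mset Suc (image_mset \<pi> M) + replicate_mset n 0 =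
        image_mset \<rho> (image_mset Suc M + replicate_mset n 0)"
      by (simp add: multiset.map_comp comp_def \<rho>_def)
    ultimately show "f (image_mset Suc (image_mset \<pi> M) + replicate_mset n 0) =
        f (image_mset Suc M + replicate_mset n 0)"
      using symmetric_function_perm[OF f, of \<rho>] by metis
  qed
qed

abbreviation insert0 :: "nat \<Rightarrow> nat multiset \<Rightarrow> nat multiset" where
  "insert0 n M \<equiv> image_mset Suc M + replicate_mset n 0"

lemma count_insert0_0: "count (insert0 n M) 0 = n"
  by (simp add: count_eq_zero_iff)

lemma count_insert0_Suc: "count (insert0 n M) (Suc k) = count M k"
  by (induction M) auto

lemma insert0_subseteq_iff: "insert0 i B \<subseteq># insert0 n M \<longleftrightarrow> i \<le> n \<and> B \<subseteq># M"
proof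
  assume "insert0 i B \<subseteq># insert0 n M"
  then have "count (insert0 i B) k \<le> count (insert0 n M) k" for k by (simp only: subseteq_mset_def)
  from this[of 0] this[of "Suc _"] show "i \<le> n \<and> B \<subseteq># M"
    by (simp only: count_insert0_0 count_insert0_Suc subseteq_mset_def) simp
next
  assume "i \<le> n \<and> B \<subseteq># M"
  then show "insert0 i B \<subseteq># insert0 n M"
    by (intro subset_mset.add_mono image_mset_subseteq_mono) (auto simp: subseteq_mset_def)
qed

lemma insert0_eq_iff: "insert0 i B = insert0 n M \<longleftrightarrow> i = n \<and> B = M"
  by (metis insert0_subseteq_iff order_antisym subset_mset.order_antisym subset_mset.order_refl order_refl)

lemma insert0_surj: "\<exists>i B. A = insert0 i B"
proof (induction A)
  case empty
  show ?case by (intro exI[of _ 0] exI[of _ "{#}"]) simp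
next
  case (add a A)
  then obtain i B where A: "A = insert0 i B" by blast
  show ?case
  proof (cases a)
    case 0 then show ?thesis by (intro exI[of _ "Suc i"] exI[of _ B]) (simp add: A)
  next
    case (Suc k) then show ?thesis by (intro exI[of _ i] exI[of _ "add_mset k B"]) (simp add: A)
  qed
qed

lemma insert0_diff: "i \<le> n \<Longrightarrow> B \<subseteq># M \<Longrightarrow> insert0 n M - insert0 i B = insert0 (n - i) (M - B)"
proof -
  have replicate_plus: "replicate_mset (i + k) (0 :: nat) = replicate_mset i 0 + replicate_mset k 0" for k
    by (induction i) simp_all
  assume "i \<le> n" "B \<subseteq># M"
  then obtain k C where "n = i + k" "M = B + C"
    by (metis le_Suc_ex subset_mset.le_iff_add)
  then have "insert0 n M = insert0 i B + insert0 (n - i) (M - B)"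
    using replicate_plus by simp
  then show ?thesis by (metis add_diff_cancel_left')
qed

lemma coeff0_mult: "coeff0 n (f * g) = (\<Sum>i\<le>n. coeff0 i f * coeff0 (n - i) g)"
proof (rule sym_eqI)
  fix M :: "nat multiset"
  let ?S = "{..n} \<times> {B. B \<subseteq># M}"
  have sub: "{A. A \<subseteq># insert0 n M} = (\<lambda>(i, B). insert0 i B) ` ?S"
  proof (intro equalityI subsetI)
    fix A assume A: "A \<in> {A. A \<subseteq># insert0 n M}"
    obtain i B where "A = insert0 i B" using insert0_surj by blast
    then show "A \<in> (\<lambda>(i, B). insert0 i B) ` ?S" using A by (auto simp: insert0_subseteq_iff)
  qed (auto simp: insert0_subseteq_iff)
  have inj: "inj_on (\<lambda>(i, B). insert0 i B) ?S" by (auto simp: inj_on_def insert0_eq_iff)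
  have "mcoeff (coeff0 n (f * g)) M =
      (\<Sum>(i, B)\<in>?S. mcoeff f (insert0 i B) * mcoeff g (insert0 n M - insert0 i B))"
    unfolding coeff0.rep_eq mcoeff_times sub sum.reindex[OF inj] by (simp add: case_prod_unfold)
  also have "\<dots> = (\<Sum>(i, B)\<in>?S. mcoeff (coeff0 i f) B * mcoeff (coeff0 (n - i) g) (M - B))"
    by (rule sum.cong) (auto simp: coeff0.rep_eq insert0_diff)
  also have "\<dots> = mcoeff (\<Sum>i\<le>n. coeff0 i f * coeff0 (n - i) g) M"
    by (simp add: mcoeff_times sum.cartesian_product)
  finally show "mcoeff (coeff0 n (f * g)) M = \<dots>" .
qed

lemma coeff0_add: "coeff0 n (f + g) = coeff0 n f + coeff0 n g"
  and coeff0_scale: "coeff0 n (scale c f) = scale c (coeff0 n f)"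
  and coeff0_zero [simp]: "coeff0 n 0 = 0"
  by (rule sym_eqI; simp add: coeff0.rep_eq)+

lemma coeff0_hsym: "coeff0 n (hsym m) = hsym (m - int n)"
  by (rule sym_eqI) (auto simp: coeff0.rep_eq mcoeff_hsym)

lemma coeff0_one: "coeff0 n 1 = (if n = 0 then 1 else 0)"
  using coeff0_hsym[of n 0] by (simp add: hsym_0 hsym_neg)

lemma coeff0_0 [simp]: "coeff0 0 f = f"
proof (rule sym_eqI)
  fix M
  obtain \<pi> :: "nat \<Rightarrow> nat" where "bij \<pi>" "\<And>x. x \<in> set_mset M \<Longrightarrow> \<pi> x = Suc x"
    using bij_extends[of Suc "set_mset M" "Suc ` set_mset M"] by (auto simp: bij_betw_def)
  then have "image_mset Suc M = image_mset \<pi> M" by (intro image_mset_cong) auto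
  then show "mcoeff (coeff0 0 f) M = mcoeff f M"
    using mcoeff_perm[OF \<open>bij \<pi>\<close>] by (simp add: coeff0.rep_eq)
qed

text \<open>Collecting the coefficients in a power series turns \<open>coeff0\<close> into a ring homomorphism, which can be
  applied to the entries of a determinant.\<close>

definition expand0 :: "sym \<Rightarrow> sym fps" where
  "expand0 f = Abs_fps (\<lambda>n. coeff0 n f)"

lemma comm_ring_hom_expand0: "comm_ring_hom expand0"
proof
  show "expand0 (f * g) = expand0 f * expand0 g" for f g
    by (rule fps_ext) (simp add: expand0_def fps_mult_nth coeff0_mult atLeast0AtMost)
qed (auto intro!: fps_ext simp: expand0_def coeff0_add coeff0_one)

section \<open>Jacobi--Trudi determinants\<close>

text \<open>Writing \<open>a\<^sub>i = \<alpha>\<^sub>i - i\<close> makes the determinant an alternating function of the sequence \<open>a\<close>.\<close>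

definition jt :: "nat \<Rightarrow> (nat \<Rightarrow> int) \<Rightarrow> sym" where
  "jt N a = det (mat N N (\<lambda>(i, j). hsym (a i + int j)))"

lemma jacobi_trudi_jt: "jacobi_trudi \<alpha> = jt (length \<alpha>) (\<lambda>i. \<alpha> ! i - int i)"
  unfolding jacobi_trudi_def jt_def by (intro arg_cong[of _ _ det] cong_mat) (auto simp: algebra_simps)

lemma jt_cong: "(\<And>i. i < N \<Longrightarrow> a i = b i) \<Longrightarrow> jt N a = jt N b"
  unfolding jt_def by (intro arg_cong[of _ _ det] cong_mat) auto

lemma jt_permute:
  assumes "p permutes {0..<N}"
  shows "jt N (\<lambda>i. a (p i)) = of_int (sign p) * jt N a"
proof -
  have "mat N N (\<lambda>(i, j). hsym (a (p i) + int j)) =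
      mat N N (\<lambda>(i, j). mat N N (\<lambda>(i, j). hsym (a i + int j)) $$ (p i, j))"
    using permutes_in_image[OF assms] by (intro cong_mat) auto
  then show ?thesis
    unfolding jt_def using det_permute_rows[of "mat N N (\<lambda>(i, j). hsym (a i + int j))" N p] assms by simp
qed

lemma jt_repeated:
  assumes "i < N" "j < N" "i \<noteq> j" "a i = a j"
  shows "jt N a = 0"
  unfolding jt_def
  by (rule det_identical_rows[of _ N i j]) (use assms in \<open>auto intro!: eq_vecI\<close>)

lemma det_leibniz:
  "det (mat N N (\<lambda>(i, j). f i j)) = (\<Sum>p | p permutes {0..<N}. of_int (sign p) * (\<Prod>i<N. f i (p i)))"
proof -
  have "det (mat N N (\<lambda>(i, j). f i j)) =
      (\<Sum>p | p permutes {0..<N}. of_int (sign p) * (\<Prod>i=0..<N. mat N N (\<lambda>(i, j). f i j) $$ (i, p i)))"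
    by (rule det_def') simp
  also have "\<dots> = (\<Sum>p | p permutes {0..<N}. of_int (sign p) * (\<Prod>i<N. f i (p i)))"
  proof (rule sum.cong[OF refl])
    fix p assume p: "p \<in> {p. p permutes {0..<N}}"
    have "(\<Prod>i=0..<N. mat N N (\<lambda>(i, j). f i j) $$ (i, p i)) = (\<Prod>i<N. f i (p i))"
    proof (rule prod.cong)
      fix i assume "i \<in> {..<N}"
      then have "p i < N" using p permutes_in_image[of p "{0..<N}" i] by simp
      then show "mat N N (\<lambda>(i, j). f i j) $$ (i, p i) = f i (p i)" using \<open>i \<in> {..<N}\<close> by simp
    qed auto
    then show "of_int (sign p) * (\<Prod>i=0..<N. mat N N (\<lambda>(i, j). f i j) $$ (i, p i)) =
        of_int (sign p) * (\<Prod>i<N. f i (p i))" by simp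
  qed
  finally show ?thesis .
qed

lemma jt_low_entry:
  assumes "i < N" "a i \<le> - int N"
  shows "jt N a = 0"
  unfolding jt_def det_leibniz
proof (intro sum.neutral ballI)
  fix p assume p: "p \<in> {p. p permutes {0..<N}}"
  then have "p i < N" using permutes_in_image[of p "{0..<N}" i] assms(1) by simp
  then have "hsym (a i + int (p i)) = 0" using assms(2) by (intro hsym_neg) simp
  then have "(\<Prod>i<N. hsym (a i + int (p i))) = 0" using assms(1) by (intro prod_zero) auto
  then show "of_int (sign p) * (\<Prod>i<N. hsym (a i + int (p i))) = 0" by simp
qed

lemma homogeneous_of_int_mult: "homogeneous n f \<Longrightarrow> homogeneous n (of_int k * f)"
  by (simp add: of_int_times_eq_scale homogeneous_scale)

lemma homogeneous_prod_hsym: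
  "finite I \<Longrightarrow> (\<Sum>i\<in>I. m i) = int n \<Longrightarrow> homogeneous n (\<Prod>i\<in>I. hsym (m i))"
proof (induction I arbitrary: n rule: finite_induct)
  case (insert i I)
  show ?case
  proof (cases "m i < 0 \<or> (\<exists>j\<in>I. m j < 0)")
    case True
    then have "(\<Prod>i\<in>insert i I. hsym (m i)) = 0"
      using insert.hyps by (intro prod_zero) (auto intro: hsym_neg)
    then show ?thesis by simp
  next
    case False
    then have "(\<Sum>i\<in>I. m i) = int (nat (\<Sum>i\<in>I. m i))" by (simp add: sum_nonneg not_less)
    then have *: "homogeneous (nat (\<Sum>i\<in>I. m i)) (\<Prod>i\<in>I. hsym (m i))" by (rule insert.IH)
    have "homogeneous (nat (m i)) (hsym (m i))" using False homogeneous_hsym[of "nat (m i)"] by simp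
    with * have "homogeneous (nat (m i) + nat (\<Sum>i\<in>I. m i)) (\<Prod>i\<in>insert i I. hsym (m i))"
      using insert.hyps by (simp add: homogeneous_mult)
    moreover have "nat (m i) + nat (\<Sum>i\<in>I. m i) = n"
      using insert.prems insert.hyps False by (simp add: sum_nonneg not_less flip: nat_add_distrib)
    ultimately show ?thesis by simp
  qed
qed simp

lemma homogeneous_jacobi_trudi:
  assumes "sum_list \<alpha> = int n"
  shows "homogeneous n (jacobi_trudi \<alpha>)"
  unfolding jacobi_trudi_jt jt_def det_leibniz
proof (intro homogeneous_sum homogeneous_of_int_mult homogeneous_prod_hsym)
  fix p assume "p \<in> {p. p permutes {0..<length \<alpha>}}"
  then have "(\<Sum>i<length \<alpha>. int (p i)) = (\<Sum>i<length \<alpha>. int i)"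
    using sum.permute[of p "{..<length \<alpha>}" int] by (simp add: lessThan_atLeast0 comp_def)
  then show "(\<Sum>i<length \<alpha>. \<alpha> ! i - int i + int (p i)) = int n"
    using assms by (simp add: sum.distrib sum_subtractf sum_list_sum_nth atLeast0LessThan)
qed simp

lemma det_last_row:
  fixes A :: "'a :: comm_ring_1 mat"
  assumes A: "A \<in> carrier_mat (Suc N) (Suc N)" and z: "\<And>j. j < N \<Longrightarrow> A $$ (N, j) = 0"
  shows "det A = A $$ (N, N) * det (mat N N (\<lambda>(i, j). A $$ (i, j)))"
proof -
  have "det A = (\<Sum>j<Suc N. A $$ (N, j) * cofactor A N j)"
    using A by (rule laplace_expansion_row) simp
  also have "\<dots> = A $$ (N, N) * cofactor A N N" using z by simp
  also have "cofactor A N N = det (mat_delete A N N)" by (simp add: cofactor_def flip: mult_2)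
  also have "mat_delete A N N = mat N N (\<lambda>(i, j). A $$ (i, j))"
    using A unfolding mat_delete_def by (intro eq_matI) auto
  finally show ?thesis .
qed

lemma jt_Suc:
  assumes "a N = - int N"
  shows "jt (Suc N) a = jt N a"
proof -
  let ?A = "mat (Suc N) (Suc N) (\<lambda>(i, j). hsym (a i + int j))"
  have "det ?A = ?A $$ (N, N) * det (mat N N (\<lambda>(i, j). ?A $$ (i, j)))"
    by (rule det_last_row) (simp_all add: assms hsym_neg)
  also have "mat N N (\<lambda>(i, j). ?A $$ (i, j)) = mat N N (\<lambda>(i, j). hsym (a i + int j))"
    by (rule cong_mat) auto
  finally show ?thesis by (simp add: jt_def assms hsym_0)
qed

text \<open>The coefficient of the \<open>n\<close>-th power in a determinant of power series distributes this power
  over the rows.\<close>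

lemma fps_nth_det:
  fixes R :: "nat \<Rightarrow> nat \<Rightarrow> nat \<Rightarrow> 'a :: comm_ring_1"
  shows "fps_nth (det (mat N N (\<lambda>(i, j). Abs_fps (R i j)))) n =
    (\<Sum>X\<in>multisets_of_size {..<N} n. det (mat N N (\<lambda>(i, j). R i j (count X i))))"
proof -
  have of_int: "fps_nth (of_int k * F) n = of_int k * fps_nth F n" for k and F :: "'a fps"
    by (simp flip: fps_of_int)
  have "fps_nth (det (mat N N (\<lambda>(i, j). Abs_fps (R i j)))) n =
     (\<Sum>p | p permutes {0..<N}. \<Sum>X\<in>multisets_of_size {..<N} n.
        of_int (sign p) * (\<Prod>i<N. R i (p i) (count X i)))"
    by (simp add: det_leibniz fps_sum_nth of_int fps_prod_nth' sum_distrib_left)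
  also have "\<dots> = (\<Sum>X\<in>multisets_of_size {..<N} n. det (mat N N (\<lambda>(i, j). R i j (count X i))))"
    unfolding det_leibniz by (rule sum.swap)
  finally show ?thesis .
qed

lemma coeff0_jt:
  "coeff0 n (jt N a) = (\<Sum>X\<in>multisets_of_size {..<N} n. jt N (\<lambda>i. a i - int (count X i)))"
proof -
  interpret comm_ring_hom expand0 by (rule comm_ring_hom_expand0)
  have "expand0 (jt N a) = det (map_mat expand0 (mat N N (\<lambda>(i, j). hsym (a i + int j))))"
    unfolding jt_def by (rule hom_det[symmetric])
  also have "map_mat expand0 (mat N N (\<lambda>(i, j). hsym (a i + int j))) =
      mat N N (\<lambda>(i, j). Abs_fps (\<lambda>b. hsym (a i - int b + int j)))"
    by (rule eq_matI) (auto simp: expand0_def coeff0_hsym algebra_simps)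
  finally have "fps_nth (expand0 (jt N a)) n = fps_nth (det \<dots>) n" by simp
  then show ?thesis by (simp add: fps_nth_det expand0_def jt_def)
qed

text \<open>Pieri's rule before cancellation.  In the matrix of the power series \<open>\<Sum>\<^sub>b u\<^sup>b h\<^bsub>a i + b + j\<^esub>\<close>, subtracting
  \<open>u\<close> times the next column from each column but the last leaves the matrix of \<open>jt\<close>, except that the
  last row becomes \<open>(0, \<dots>, 0, \<Sum>\<^sub>b u\<^sup>b h\<^sub>b)\<close>.\<close>

lemma hsym_times_jt:
  assumes a: "a N = - int N"
  shows "hsym (int n) * jt N a =
    (\<Sum>X\<in>multisets_of_size {..<Suc N} n. jt (Suc N) (\<lambda>i. a i + int (count X i)))"
proof -
  let ?f = "\<lambda>i j. Abs_fps (\<lambda>b. hsym (a i + int b + int j))"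
  let ?M = "mat (Suc N) (Suc N) (\<lambda>(i, j). ?f i j)"
  let ?E = "mat (Suc N) (Suc N) (\<lambda>(i, j). if i = j then 1 else if i = Suc j then - fps_X else 0 :: sym fps)"
  let ?M' = "mat (Suc N) (Suc N) (\<lambda>(i, j). if j < N then fps_const (hsym (a i + int j)) else ?f i N)"
  have "det ?E = prod_list (diag_mat ?E)"
    by (rule det_lower_triangular[of "Suc N"]) auto
  also have "diag_mat ?E = map (\<lambda>i. 1) [0..<Suc N]"
    unfolding diag_mat_def by (intro map_cong) auto
  finally have E: "det ?E = 1" by (simp add: map_replicate_const)
  have step: "?f i j - fps_X * ?f i (Suc j) = fps_const (hsym (a i + int j))" for i j
    by (rule fps_ext) (auto simp: fps_X_mult_nth algebra_simps of_nat_diff)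
  have "?M * ?E = ?M'"
  proof (rule eq_matI)
    fix i j assume ij: "i < dim_row ?M'" "j < dim_col ?M'"
    have "(?M * ?E) $$ (i, j) = (\<Sum>k<Suc N. ?f i k * (if k = j then 1 else if k = Suc j then - fps_X else 0))"
      using ij by (simp add: scalar_prod_def atLeast0LessThan)
    also have "\<dots> = (\<Sum>k<Suc N. (if k = j then ?f i k else 0) + (if k = Suc j then - (fps_X * ?f i k) else 0))"
      by (intro sum.cong) (auto simp: mult.commute)
    also have "\<dots> = ?f i j + (if Suc j < Suc N then - (fps_X * ?f i (Suc j)) else 0)"
      unfolding sum.distrib sum.delta[OF finite_lessThan] lessThan_iff using ij(2) by auto
    also have "\<dots> = ?M' $$ (i, j)"
    proof (cases "j < N")
      case True
      then show ?thesis using ij step[of i j] by simp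
    next
      case False
      then have "j = N" using ij by simp
      then show ?thesis using ij by simp
    qed
    finally show "(?M * ?E) $$ (i, j) = ?M' $$ (i, j)" .
  qed auto
  then have "det ?M = det ?M'"
    using det_mult[of ?M "Suc N" ?E] by (simp only: E) simp
  also have "\<dots> = ?M' $$ (N, N) * det (mat N N (\<lambda>(i, j). ?M' $$ (i, j)))"
    by (rule det_last_row) (simp_all add: a hsym_neg)
  also have "mat N N (\<lambda>(i, j). ?M' $$ (i, j)) = map_mat fps_const (mat N N (\<lambda>(i, j). hsym (a i + int j)))"
    by (rule eq_matI) auto
  also have "det \<dots> = fps_const (jt N a)"
  proof -
    interpret comm_ring_hom "fps_const :: sym \<Rightarrow> sym fps" by standard auto
    show ?thesis by (simp add: jt_def)
  qed
  finally have "fps_nth (det ?M) n = hsym (int n) * jt N a"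
    by (simp add: a)
  then show ?thesis by (simp add: fps_nth_det jt_def)
qed

section \<open>Bases indexed by partitions\<close>

lemma mset_inj_partitions: "inj_on mset partitions"
proof (rule inj_onI)
  fix \<mu> \<nu> assume "\<mu> \<in> partitions" "\<nu> \<in> partitions" "mset \<mu> = mset \<nu>"
  then have "sorted (rev \<mu>)" "sorted (rev \<nu>)" "mset (rev \<mu>) = mset (rev \<nu>)"
    by (simp_all add: partitions_def sorted_wrt_rev)
  then have "rev \<mu> = rev \<nu>" by (metis properties_for_sort)
  then show "\<mu> = \<nu>" by simp
qed

definition parts :: "nat \<Rightarrow> nat list set" where
  "parts n = {\<mu> \<in> partitions. sum_list \<mu> = n}"

lemma mset_parts: "mset ` parts n = part_msets n"
proof (intro equalityI subsetI)
  fix A assume A: "A \<in> part_msets n"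
  let ?l = "rev (sorted_list_of_multiset A)"
  have "mset ?l = A" by simp
  moreover from this have "?l \<in> parts n"
    using A by (auto simp: parts_def partitions_def part_msets_def sorted_wrt_rev
        simp flip: sum_mset_sum_list)
  ultimately show "A \<in> mset ` parts n" by (metis imageI)
qed (auto simp: parts_def partitions_def part_msets_def sum_mset_sum_list)

lemma inj_on_mset_parts: "inj_on mset (parts n)"
  using mset_inj_partitions by (rule inj_on_subset) (auto simp: parts_def)

lemma finite_parts: "finite (parts n)"
  using finite_part_msets[of n] inj_on_mset_parts[of n] by (simp add: mset_parts finite_image_iff flip: mset_parts)

lemma hcomponent_add: "hcomponent n (f + g) = hcomponent n f + hcomponent n g"
  and hcomponent_scale: "hcomponent n (scale c f) = scale c (hcomponent n f)"
  and hcomponent_0 [simp]: "hcomponent n 0 = 0"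
  by (rule sym_eqI; simp)+

lemma hcomponent_sum: "hcomponent n (sum f A) = (\<Sum>x\<in>A. hcomponent n (f x))"
  by (induction A rule: infinite_finite_induct) (simp_all add: hcomponent_add)

text \<open>What the Schur functions and the products of power sums have in common as bases: coordinates are
  linear, determine a symmetric function, and respect degrees.\<close>

locale graded_basis =
  fixes b :: "nat list \<Rightarrow> sym"
  assumes relation_trivial: "finite S \<Longrightarrow> S \<subseteq> partitions \<Longrightarrow>
      (\<Sum>\<mu>\<in>S. scale (c \<mu>) (b \<mu>)) = 0 \<Longrightarrow> \<mu> \<in> S \<Longrightarrow> c \<mu> = 0"
    and spans: "sym.span (b ` partitions) = UNIV"
    and homogeneous_basis: "\<mu> \<in> partitions \<Longrightarrow> homogeneous (sum_list \<mu>) (b \<mu>)"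
begin

definition coord :: "sym \<Rightarrow> nat list \<Rightarrow> rat" where
  "coord f \<mu> = sym.representation (b ` partitions) f (b \<mu>)"

lemma inj: "inj_on b partitions"
proof (rule inj_onI, rule ccontr)
  fix \<mu> \<nu> assume "\<mu> \<in> partitions" "\<nu> \<in> partitions" "b \<mu> = b \<nu>" "\<mu> \<noteq> \<nu>"
  then have "(if \<mu> = \<mu> then 1 else - 1 :: rat) = 0"
    by (intro relation_trivial[of "{\<mu>, \<nu>}"]) auto
  then show False by simp
qed

lemma independent: "sym.independent (b ` partitions)"
  unfolding sym.independent_explicit_finite_subsets
proof (intro allI impI ballI)
  fix S u v assume S: "S \<subseteq> b ` partitions" "finite S"
    and rel: "(\<Sum>v\<in>S. scale (u v) v) = 0" and "v \<in> S"
  obtain T where T: "T \<subseteq> partitions" "S = b ` T" using S(1) by (auto simp: subset_image_iff)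
  have inj': "inj_on b T" using T(1) inj by (rule inj_on_subset[rotated])
  then have "(\<Sum>\<mu>\<in>T. scale (u (b \<mu>)) (b \<mu>)) = 0" using rel by (simp add: T(2) sum.reindex)
  moreover have "finite T" using S(2) T(2) inj' by (simp add: finite_image_iff)
  moreover obtain \<mu> where "\<mu> \<in> T" "v = b \<mu>" using \<open>v \<in> S\<close> T(2) by auto
  ultimately show "u v = 0" using relation_trivial[of T "\<lambda>\<mu>. u (b \<mu>)" \<mu>] T(1) by auto
qed

lemma coord_add: "coord (f + g) \<mu> = coord f \<mu> + coord g \<mu>"
  and coord_scale: "coord (scale c f) \<mu> = c * coord f \<mu>"
  and coord_0 [simp]: "coord 0 \<mu> = 0"
  by (simp_all add: coord_def sym.representation_add sym.representation_scale sym.representation_zero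
      independent spans)

lemma coord_sum: "coord (sum f A) \<mu> = (\<Sum>x\<in>A. coord (f x) \<mu>)"
  by (induction A rule: infinite_finite_induct) (simp_all add: coord_add)

lemma coord_basis: "\<mu> \<in> partitions \<Longrightarrow> \<nu> \<in> partitions \<Longrightarrow> coord (b \<nu>) \<mu> = (if \<mu> = \<nu> then 1 else 0)"
  by (auto simp: coord_def sym.representation_basis[OF independent] dest: inj_onD[OF inj])

lemma finite_coord: "finite {\<mu> \<in> partitions. coord f \<mu> \<noteq> 0}"
proof -
  have "finite (b -` {v. sym.representation (b ` partitions) f v \<noteq> 0} \<inter> partitions)"
    using sym.finite_representation inj by (rule finite_vimage_IntI)
  then show ?thesis by (rule finite_subset[rotated]) (auto simp: coord_def)
qed

lemma expansion:
  assumes "finite S" "S \<subseteq> partitions" "{\<mu> \<in> partitions. coord f \<mu> \<noteq> 0} \<subseteq> S"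
  shows "f = (\<Sum>\<mu>\<in>S. scale (coord f \<mu>) (b \<mu>))"
proof -
  let ?R = "sym.representation (b ` partitions) f"
  have inj': "inj_on b S" using assms(2) inj by (rule inj_on_subset[rotated])
  have "f = (\<Sum>v | ?R v \<noteq> 0. scale (?R v) v)"
    using independent spans by (simp add: sym.sum_nonzero_representation_eq)
  also have "\<dots> = (\<Sum>v\<in>b ` S. scale (?R v) v)"
  proof (rule sum.mono_neutral_left)
    show "{v. ?R v \<noteq> 0} \<subseteq> b ` S"
    proof
      fix v assume v: "v \<in> {v. ?R v \<noteq> 0}"
      then obtain \<mu> where "\<mu> \<in> partitions" "v = b \<mu>" using sym.representation_ne_zero by blast
      then show "v \<in> b ` S" using v assms(3) by (auto simp: coord_def)
    qed
  qed (use assms in auto)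
  also have "\<dots> = (\<Sum>\<mu>\<in>S. scale (coord f \<mu>) (b \<mu>))"
    by (simp add: sum.reindex[OF inj'] coord_def)
  finally show ?thesis .
qed

lemma coord_eqI: "(\<And>\<mu>. \<mu> \<in> partitions \<Longrightarrow> coord f \<mu> = coord g \<mu>) \<Longrightarrow> f = g"
proof -
  assume eq: "\<And>\<mu>. \<mu> \<in> partitions \<Longrightarrow> coord f \<mu> = coord g \<mu>"
  let ?S = "{\<mu> \<in> partitions. coord f \<mu> \<noteq> 0}"
  have "f = (\<Sum>\<mu>\<in>?S. scale (coord f \<mu>) (b \<mu>))" by (rule expansion[OF finite_coord]) auto
  also have "\<dots> = (\<Sum>\<mu>\<in>?S. scale (coord g \<mu>) (b \<mu>))" by (rule sum.cong) (auto simp: eq)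
  also have "\<dots> = g" by (rule expansion[OF finite_coord, symmetric]) (auto simp: eq)
  finally show "f = g" .
qed

lemma coord_hcomponent:
  assumes "\<mu> \<in> partitions"
  shows "coord (hcomponent n f) \<mu> = (if sum_list \<mu> = n then coord f \<mu> else 0)"
proof -
  let ?S = "{\<mu> \<in> partitions. coord f \<mu> \<noteq> 0}"
  have "f = (\<Sum>\<nu>\<in>?S. scale (coord f \<nu>) (b \<nu>))" by (rule expansion[OF finite_coord]) auto
  then have "hcomponent n f = (\<Sum>\<nu>\<in>?S. scale (coord f \<nu>) (hcomponent n (b \<nu>)))"
    by (metis (no_types, lifting) hcomponent_scale hcomponent_sum sum.cong)
  also have "\<dots> = (\<Sum>\<nu>\<in>?S. scale (if sum_list \<nu> = n then coord f \<nu> else 0) (b \<nu>))"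
  proof (rule sum.cong[OF refl])
    fix \<nu> assume "\<nu> \<in> ?S"
    then have "homogeneous (sum_list \<nu>) (b \<nu>)" using homogeneous_basis by auto
    then have "hcomponent n (b \<nu>) = (if sum_list \<nu> = n then b \<nu> else 0)"
      using hcomponent_homogeneous hcomponent_homogeneous_other by auto
    then show "scale (coord f \<nu>) (hcomponent n (b \<nu>)) =
        scale (if sum_list \<nu> = n then coord f \<nu> else 0) (b \<nu>)" by simp
  qed
  finally have "coord (hcomponent n f) \<mu> =
      (\<Sum>\<nu>\<in>?S. (if sum_list \<nu> = n then coord f \<nu> else 0) * coord (b \<nu>) \<mu>)"
    by (simp add: coord_sum coord_scale)
  also have "\<dots> = (\<Sum>\<nu>\<in>?S. if \<nu> = \<mu> then (if sum_list \<mu> = n then coord f \<mu> else 0) else 0)"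
    using assms by (intro sum.cong) (auto simp: coord_basis)
  also have "\<dots> = (if sum_list \<mu> = n then coord f \<mu> else 0)"
    using assms finite_coord by (auto simp: sum.delta)
  finally show ?thesis .
qed

lemma coord_homogeneous:
  "homogeneous n f \<Longrightarrow> \<mu> \<in> partitions \<Longrightarrow> sum_list \<mu> \<noteq> n \<Longrightarrow> coord f \<mu> = 0"
  using coord_hcomponent[of \<mu> n f] by (simp add: hcomponent_homogeneous)

end

lemma graded_basis_power_sum: "graded_basis power_sum"
proof
  fix S c \<mu> assume S: "finite S" "S \<subseteq> partitions" "(\<Sum>\<mu>\<in>S. scale (c \<mu>) (power_sum \<mu>)) = 0" "\<mu> \<in> S"
  have inj: "inj_on mset S" using S(2) mset_inj_partitions by (rule inj_on_subset[rotated])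
  have "(\<Sum>A\<in>mset ` S. scale (c (inv_into S mset A)) (psums A)) = 0"
    using S(3) inj by (simp add: sum.reindex power_sum_psums)
  then have "c (inv_into S mset (mset \<mu>)) = 0"
    using S by (intro psums_relation_trivial[of "mset ` S" "\<lambda>A. c (inv_into S mset A)"])
      (auto simp: partitions_def)
  then show "c \<mu> = 0" using inj S(4) by simp
next
  have "f \<in> sym.span (power_sum ` partitions)" for f
  proof -
    obtain d where d: "\<And>M. mcoeff f M \<noteq> 0 \<Longrightarrow> size M \<le> d" using mcoeff_bounded by blast
    have "hcomponent n f \<in> sym.span (power_sum ` partitions)" for n
    proof -
      have "hcomponent n f \<in> sym.span (psums ` part_msets n)" by (intro psums_span) simp
      moreover have "psums ` part_msets n \<subseteq> power_sum ` partitions"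
        by (auto simp: parts_def power_sum_psums simp flip: mset_parts)
      ultimately show ?thesis using sym.span_mono by blast
    qed
    then show ?thesis by (subst hcomponents_sum[OF d]) (auto intro: sym.span_sum)
  qed
  then show "sym.span (power_sum ` partitions) = UNIV" by auto
next
  fix \<mu> :: "nat list"
  show "homogeneous (sum_list \<mu>) (power_sum \<mu>)"
    using homogeneous_psums[of "mset \<mu>"] by (simp add: power_sum_psums sum_mset_sum_list)
qed

global_interpretation power_sum: graded_basis power_sum
  rewrites "graded_basis.coord power_sum = power_sum_coeff"
proof -
  show "graded_basis power_sum" by (rule graded_basis_power_sum)
  then show "graded_basis.coord power_sum = power_sum_coeff"
    by (intro ext) (simp add: graded_basis.coord_def power_sum_coeff_def)
qed

section \<open>Straightening, and the Schur basis\<close>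

lemma jt_sorted:
  assumes "sorted_wrt (\<ge>) \<nu>"
  shows "jt (length \<nu>) (\<lambda>i. int (\<nu> ! i) - int i) = schur (filter (\<lambda>x. x \<noteq> 0) \<nu>)"
  using assms
proof (induction \<nu> rule: rev_induct)
  case Nil
  show ?case by (simp add: schur_def jacobi_trudi_jt) (rule jt_cong, simp)
next
  case (snoc x \<nu>)
  show ?case
  proof (cases "x = 0")
    case True
    have "jt (length (\<nu> @ [x])) (\<lambda>i. int ((\<nu> @ [x]) ! i) - int i) =
        jt (length \<nu>) (\<lambda>i. int ((\<nu> @ [x]) ! i) - int i)"
      using jt_Suc[of "\<lambda>i. int ((\<nu> @ [x]) ! i) - int i" "length \<nu>"] True by simp
    also have "\<dots> = jt (length \<nu>) (\<lambda>i. int (\<nu> ! i) - int i)"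
      by (rule jt_cong) (simp add: nth_append)
    finally show ?thesis using snoc True by (simp add: sorted_wrt_append)
  next
    case False
    then have "filter (\<lambda>x. x \<noteq> 0) (\<nu> @ [x]) = \<nu> @ [x]"
      using snoc.prems by (auto simp: sorted_wrt_append filter_id_conv)
    moreover have "schur (\<nu> @ [x]) = jt (length (\<nu> @ [x])) (\<lambda>i. int ((\<nu> @ [x]) ! i) - int i)"
      unfolding schur_def jacobi_trudi_jt length_map
      by (rule jt_cong) (auto simp: nth_append less_Suc_eq)
    ultimately show ?thesis by simp
  qed
qed

lemma filter_nonzero_partitions: "sorted_wrt (\<ge>) \<nu> \<Longrightarrow> filter (\<lambda>x. x \<noteq> 0) \<nu> \<in> partitions"
  by (auto simp: partitions_def sorted_wrt_filter)

text \<open>Sorting decides the fate of a Jacobi--Trudi determinant.  If two entries of \<open>c\<close> coincide, or one of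
  them is so small that its row vanishes, the determinant is 0.  Otherwise \<open>c\<close> can be sorted into a strictly
  decreasing sequence, and adding \<open>i\<close> to its \<open>i\<close>-th entry gives a partition padded with zeros.\<close>

lemma straighten:
  assumes inj: "inj_on c {..<N}" and low: "\<And>i. i < N \<Longrightarrow> c i > - int N"
  obtains p \<nu> where "p permutes {0..<N}" "length \<nu> = N" "sorted_wrt (\<ge>) \<nu>"
    "\<And>i. i < N \<Longrightarrow> c (p i) = int (\<nu> ! i) - int i"
proof -
  define xs where "xs = rev (sort (map c [0..<N]))"
  have len: "length xs = N" by (simp add: xs_def)
  have "mset xs = mset (map c [0..<N])" by (simp add: xs_def)
  then obtain p where p: "p permutes {..<length (map c [0..<N])}" "permute_list p (map c [0..<N]) = xs"
    by (rule mset_eq_permutation)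
  have p1: "p permutes {0..<N}" using p(1) by (simp add: lessThan_atLeast0)
  have xs: "xs ! i = c (p i)" if "i < N" for i
    using that p permutes_in_image[OF p1, of i] permute_list_nth[of p "map c [0..<N]" i] by simp
  have "distinct (sort (map c [0..<N]))" using inj by (simp add: distinct_map lessThan_atLeast0)
  then have "sorted_wrt (<) (sort (map c [0..<N]))" by (simp add: strict_sorted_iff)
  then have dec: "sorted_wrt (>) xs" by (simp add: xs_def sorted_wrt_rev)
  have step: "xs ! i + int i \<ge> xs ! j + int j" if "i \<le> j" "j < N" for i j
    using that
  proof (induction j rule: dec_induct)
    case (step j)
    have "xs ! j > xs ! Suc j" using dec step.prems len by (auto simp: sorted_wrt_iff_nth_less)
    then show ?case using step by simp
  qed simp
  have nonneg: "xs ! i + int i \<ge> 0" if "i < N" for i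
  proof -
    have "p (N - 1) < N" using permutes_in_image[OF p1, of "N - 1"] that by simp
    then have "xs ! (N - 1) > - int N" using low xs[of "N - 1"] that by simp
    moreover have "xs ! i + int i \<ge> xs ! (N - 1) + int (N - 1)" using step[of i "N - 1"] that by simp
    ultimately show ?thesis using that by linarith
  qed
  show ?thesis
  proof (rule that[OF p1])
    show "length (map (\<lambda>i. nat (xs ! i + int i)) [0..<N]) = N" by simp
    show "sorted_wrt (\<ge>) (map (\<lambda>i. nat (xs ! i + int i)) [0..<N])"
      unfolding sorted_wrt_iff_nth_less using step by (auto intro: nat_mono)
    show "c (p i) = int (map (\<lambda>i. nat (xs ! i + int i)) [0..<N] ! i) - int i" if "i < N" for i
      using that nonneg[OF that] xs by simp
  qed
qed

lemma jt_straightened: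
  assumes "p permutes {0..<N}" "length \<nu> = N" "sorted_wrt (\<ge>) \<nu>"
    "\<And>i. i < N \<Longrightarrow> c (p i) = int (\<nu> ! i) - int i"
  shows "jt N c = scale (of_int (sign p)) (schur (filter (\<lambda>x. x \<noteq> 0) \<nu>))"
proof -
  have "schur (filter (\<lambda>x. x \<noteq> 0) \<nu>) = jt N (\<lambda>i. int (\<nu> ! i) - int i)"
    using jt_sorted[OF assms(3)] assms(2) by simp
  also have "\<dots> = jt N (\<lambda>i. c (p i))" by (rule jt_cong) (simp add: assms(4))
  also have "\<dots> = scale (of_int (sign p)) (jt N c)"
    using assms(1) by (simp add: jt_permute of_int_times_eq_scale)
  finally show ?thesis by (simp flip: of_int_mult)
qed

lemma jt_in_schur_span: "jt N c \<in> sym.span (schur ` partitions)"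
proof (cases "inj_on c {..<N} \<and> (\<forall>i<N. c i > - int N)")
  case True
  then obtain p \<nu> where "p permutes {0..<N}" "length \<nu> = N" "sorted_wrt (\<ge>) \<nu>"
    "\<And>i. i < N \<Longrightarrow> c (p i) = int (\<nu> ! i) - int i"
    using straighten[of c N] by blast
  then have eq: "jt N c = scale (of_int (sign p)) (schur (filter (\<lambda>x. x \<noteq> 0) \<nu>))"
    by (intro jt_straightened)
  show ?thesis
    unfolding eq using \<open>sorted_wrt (\<ge>) \<nu>\<close>
    by (intro sym.span_scale sym.span_base imageI filter_nonzero_partitions)
next
  case False
  then consider "\<not> inj_on c {..<N}" | i where "i < N" "c i \<le> - int N" by force
  then have "jt N c = 0"
  proof cases
    case 1
    then obtain i j where "i < N" "j < N" "i \<noteq> j" "c i = c j" by (auto simp: inj_on_def)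
    then show ?thesis by (rule jt_repeated)
  qed (rule jt_low_entry)
  then show ?thesis by (simp add: sym.span_zero)
qed

lemma hsym_times_schur_span:
  assumes "f \<in> sym.span (schur ` partitions)"
  shows "hsym (int n) * f \<in> sym.span (schur ` partitions)"
  using assms
proof (induction f rule: sym.span_induct_alt)
  case (step c x f)
  obtain \<mu> where x: "x = schur \<mu>" using step by auto
  define a where "a i = (if i < length \<mu> then int (\<mu> ! i) - int i else - int i)" for i
  have "x = jt (length \<mu>) a"
    unfolding x schur_def jacobi_trudi_jt length_map by (rule jt_cong) (simp add: a_def)
  then have "hsym (int n) * x \<in> sym.span (schur ` partitions)"
    by (simp add: hsym_times_jt a_def sym.span_sum jt_in_schur_span)
  then show ?case
    using step by (simp add: distrib_left scale_mult_right sym.span_add sym.span_scale)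
qed (simp add: sym.span_zero)

lemma psym_times_schur_span:
  assumes "f \<in> sym.span (schur ` partitions)" "n > 0"
  shows "psym n * f \<in> sym.span (schur ` partitions)"
  using assms
proof (induction n arbitrary: f rule: less_induct)
  case (less n)
  have "{1..n} = insert n {1..<n}" using less.prems(2) by auto
  then have "of_nat n * hsym (int n) = psym n + (\<Sum>i=1..<n. psym i * hsym (int (n - i)))"
    unfolding newton_identity by (simp add: hsym_0)
  then have "psym n = of_nat n * hsym (int n) - (\<Sum>i=1..<n. psym i * hsym (int (n - i)))"
    by (simp only: add_diff_cancel_right')
  then have "psym n * f = of_nat n * hsym (int n) * f - (\<Sum>i=1..<n. psym i * hsym (int (n - i))) * f"
    by (simp only: left_diff_distrib)
  then have "psym n * f =
      scale (of_nat n) (hsym (int n) * f) - (\<Sum>i=1..<n. psym i * (hsym (int (n - i)) * f))"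
    by (simp only: of_nat_times_eq_scale scale_mult_left sum_distrib_right mult.assoc)
  also have "\<dots> \<in> sym.span (schur ` partitions)"
    using less by (intro sym.span_diff sym.span_scale sym.span_sum hsym_times_schur_span less.IH) auto
  finally show ?case .
qed

lemma schur_Nil: "schur [] = 1"
  by (simp add: schur_def jacobi_trudi_def)

text \<open>The span of the Schur functions contains 1.  It is closed under multiplication by the \<open>h\<^sub>n\<close>, as
  Pieri's rule and straightening show, hence by the \<open>p\<^sub>n\<close> by Newton's identity.\<close>

lemma schur_spans: "sym.span (schur ` partitions) = UNIV"
proof -
  have "psums A \<in> sym.span (schur ` partitions)" if "0 \<notin># A" for A
    using that
  proof (induction A)
    case empty
    have "schur [] \<in> schur ` partitions" by (rule imageI) (simp add: partitions_def)
    from sym.span_base[OF this] show ?case by (simp only: schur_Nil psums_empty)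
  qed (simp add: psym_times_schur_span)
  then have "power_sum ` partitions \<subseteq> sym.span (schur ` partitions)"
    by (auto simp: power_sum_psums partitions_def)
  then have "sym.span (power_sum ` partitions) \<subseteq> sym.span (schur ` partitions)"
    by (simp add: sym.span_minimal)
  then show ?thesis using power_sum.spans by auto
qed

lemma homogeneous_schur: "homogeneous (sum_list \<mu>) (schur \<mu>)"
  unfolding schur_def by (rule homogeneous_jacobi_trudi) (simp add: sum_list_of_nat)

lemma span_homogeneous_schur:
  assumes "homogeneous n f"
  shows "f \<in> sym.span (schur ` parts n)"
proof -
  have "f \<in> sym.span (schur ` partitions)" by (simp add: schur_spans)
  then have "hcomponent n f \<in> sym.span (schur ` parts n)"
  proof (induction f rule: sym.span_induct_alt)
    case (step c x f)
    then obtain \<mu> where \<mu>: "x = schur \<mu>" "\<mu> \<in> partitions" by auto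
    have "hcomponent n x \<in> sym.span (schur ` parts n)"
    proof (cases "sum_list \<mu> = n")
      case True
      then show ?thesis
        using \<mu> homogeneous_schur[of \<mu>]
        by (auto simp: hcomponent_homogeneous parts_def intro: sym.span_base)
    next
      case False
      then show ?thesis
        using \<mu> homogeneous_schur[of \<mu>] by (simp add: hcomponent_homogeneous_other sym.span_zero)
    qed
    then show ?case
      using step by (simp add: hcomponent_add hcomponent_scale sym.span_add sym.span_scale)
  qed (simp add: sym.span_zero)
  then show ?thesis by (simp add: hcomponent_homogeneous assms)
qed

text \<open>An independent set of at least \<open>card T\<close> vectors in the span of \<open>T\<close> leaves no room for a redundant
  element of \<open>T\<close>.\<close>

lemma independent_of_card:
  assumes S: "sym.independent S" "S \<subseteq> sym.span T" and T: "finite T" "card T \<le> card S"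
  shows "sym.independent T"
proof
  assume "sym.dependent T"
  then obtain t where t: "t \<in> T" "t \<in> sym.span (T - {t})" by (auto simp: sym.dependent_def)
  then have "sym.span T = sym.span (T - {t})" by (metis insert_Diff sym.span_redundant)
  then have "card S \<le> card (T - {t})"
    using sym.independent_span_bound[of "T - {t}" S] S T(1) by simp
  also have "\<dots> < card T" using t T(1) by (metis card_Diff1_less)
  finally show False using T(2) by simp
qed

text \<open>In degree \<open>n\<close> there are as many Schur functions as power sums.  As they span, they are linearly
  independent.\<close>

lemma independent_schur_parts: "sym.independent (schur ` parts n)" "inj_on schur (parts n)"
proof -
  let ?P = "power_sum ` parts n"
  have sub: "parts n \<subseteq> partitions" by (auto simp: parts_def)
  have P: "sym.independent ?P"
    using power_sum.independent by (rule sym.independent_mono) (use sub in auto)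
  have cP: "card ?P = card (parts n)"
    using power_sum.inj sub by (intro card_image) (rule inj_on_subset)
  have "?P \<subseteq> sym.span (schur ` parts n)"
  proof
    fix f assume "f \<in> ?P"
    then have "homogeneous n f" using power_sum.homogeneous_basis by (auto simp: parts_def)
    then show "f \<in> sym.span (schur ` parts n)" by (rule span_homogeneous_schur)
  qed
  moreover have le: "card (schur ` parts n) \<le> card ?P" unfolding cP by (simp add: card_image_le finite_parts)
  ultimately show "sym.independent (schur ` parts n)"
    by (intro independent_of_card[OF P]) (simp_all add: finite_parts)
  have "card ?P \<le> card (schur ` parts n)"
    using sym.independent_span_bound[OF _ P \<open>?P \<subseteq> _\<close>] finite_parts by simp
  then show "inj_on schur (parts n)"
    using le cP by (intro eq_card_imp_inj_on) (simp_all add: finite_parts)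
qed

lemma graded_basis_schur: "graded_basis schur"
proof
  fix S c \<mu>0 assume S: "finite S" "S \<subseteq> partitions" "(\<Sum>\<mu>\<in>S. scale (c \<mu>) (schur \<mu>)) = 0" "\<mu>0 \<in> S"
  let ?n = "sum_list \<mu>0"
  let ?T = "{\<mu> \<in> S. sum_list \<mu> = ?n}"
  have T: "?T \<subseteq> parts ?n" "finite ?T" using S by (auto simp: parts_def)
  have hc: "hcomponent ?n (schur \<mu>) = (if sum_list \<mu> = ?n then schur \<mu> else 0)" for \<mu>
    using homogeneous_schur[of \<mu>] hcomponent_homogeneous hcomponent_homogeneous_other by auto
  have "0 = hcomponent ?n (\<Sum>\<mu>\<in>S. scale (c \<mu>) (schur \<mu>))" by (simp add: S(3))
  also have "\<dots> = (\<Sum>\<mu>\<in>S. if sum_list \<mu> = ?n then scale (c \<mu>) (schur \<mu>) else 0)"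
    by (auto simp: hcomponent_sum hcomponent_scale hc intro: sum.cong)
  also have "\<dots> = (\<Sum>\<mu>\<in>?T. scale (c \<mu>) (schur \<mu>))" using S(1) by (simp add: sum.inter_filter)
  finally have rel: "(\<Sum>\<mu>\<in>?T. scale (c \<mu>) (schur \<mu>)) = 0" ..
  have inj: "inj_on schur ?T" using independent_schur_parts(2) T(1) by (rule inj_on_subset)
  have "(\<Sum>v\<in>schur ` ?T. scale (c (inv_into ?T schur v)) v) = 0"
  proof -
    have "(\<Sum>v\<in>schur ` ?T. scale (c (inv_into ?T schur v)) v) = (\<Sum>\<mu>\<in>?T. scale (c \<mu>) (schur \<mu>))"
      unfolding sum.reindex[OF inj] comp_def by (intro sum.cong refl) (simp only: inv_into_f_f[OF inj])
    then show ?thesis using rel by simp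
  qed
  moreover have "sym.independent (schur ` ?T)"
    using independent_schur_parts(1) T(1) by (rule sym.independent_mono[OF _ image_mono])
  ultimately have "c (inv_into ?T schur (schur \<mu>0)) = 0"
    using S(4) T(2) sym.independentD[of "schur ` ?T" "schur ` ?T" "\<lambda>v. c (inv_into ?T schur v)" "schur \<mu>0"]
    by simp
  then show "c \<mu>0 = 0" using S(4) by (simp add: inv_into_f_f[OF inj])
qed (use schur_spans homogeneous_schur in auto)

global_interpretation schur: graded_basis schur
  rewrites "graded_basis.coord schur = schur_coeff"
proof -
  show "graded_basis schur" by (rule graded_basis_schur)
  then show "graded_basis.coord schur = schur_coeff"
    by (intro ext) (simp add: graded_basis.coord_def schur_coeff_def)
qed

section \<open>The Hall inner product\<close>

lemma hall_eq_sum: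
  assumes "finite S" "S \<subseteq> partitions" "{\<mu> \<in> partitions. schur_coeff f \<mu> \<noteq> 0} \<subseteq> S"
  shows "hall f g = (\<Sum>\<mu>\<in>S. schur_coeff f \<mu> * schur_coeff g \<mu>)"
  unfolding hall_def by (rule sum.mono_neutral_left) (use assms in auto)

lemma hall_commute: "hall f g = hall g f"
proof -
  let ?S = "{\<mu> \<in> partitions. schur_coeff f \<mu> \<noteq> 0} \<union> {\<mu> \<in> partitions. schur_coeff g \<mu> \<noteq> 0}"
  have fin: "finite ?S" by (intro finite_UnI schur.finite_coord)
  have "hall f g = (\<Sum>\<mu>\<in>?S. schur_coeff f \<mu> * schur_coeff g \<mu>)"
    by (rule hall_eq_sum[OF fin]) auto
  also have "\<dots> = (\<Sum>\<mu>\<in>?S. schur_coeff g \<mu> * schur_coeff f \<mu>)" by (simp only: mult.commute)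
  also have "\<dots> = hall g f" by (rule hall_eq_sum[OF fin, symmetric]) auto
  finally show ?thesis .
qed

lemma hall_add_right: "hall f (g + h) = hall f g + hall f h"
  and hall_scale_right: "hall f (scale c g) = c * hall f g"
  by (simp_all add: hall_def schur.coord_add schur.coord_scale distrib_left sum.distrib sum_distrib_left
      mult.left_commute)

lemma hall_zero_right [simp]: "hall f 0 = 0"
  by (simp add: hall_def)

lemma hall_sum_right: "hall f (sum g A) = (\<Sum>x\<in>A. hall f (g x))"
  by (induction A rule: infinite_finite_induct) (simp_all add: hall_add_right)

lemma hall_add_left: "hall (f + g) h = hall f h + hall g h"
  and hall_scale_left: "hall (scale c f) h = c * hall f h"
  and hall_zero_left [simp]: "hall 0 f = 0"
  and hall_sum_left: "hall (sum k A) h = (\<Sum>x\<in>A. hall (k x) h)"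
  by (simp_all only: hall_commute[of _ h] hall_commute[of 0]
      hall_add_right hall_scale_right hall_zero_right hall_sum_right)

lemma hall_schur_left: "\<mu> \<in> partitions \<Longrightarrow> hall (schur \<mu>) g = schur_coeff g \<mu>"
  by (subst hall_eq_sum[of "{\<mu>}"]) (auto simp: schur.coord_basis split: if_splits)

lemma hall_schur_right: "\<mu> \<in> partitions \<Longrightarrow> hall g (schur \<mu>) = schur_coeff g \<mu>"
  by (simp add: hall_commute[of g] hall_schur_left)

lemma hall_nondegenerate: "(\<And>\<mu>. \<mu> \<in> partitions \<Longrightarrow> hall f (schur \<mu>) = hall g (schur \<mu>)) \<Longrightarrow> f = g"
  by (rule schur.coord_eqI) (simp add: hall_schur_right)

lemma schur_induct:
  assumes "\<And>c \<mu> f. \<mu> \<in> partitions \<Longrightarrow> P f \<Longrightarrow> P (scale c (schur \<mu>) + f)" "P 0"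
  shows "P f"
proof -
  have "f \<in> sym.span (schur ` partitions)" by (simp add: schur.spans)
  then show ?thesis by (induction rule: sym.span_induct_alt) (use assms in auto)
qed

lemma sorted_eq_filter_append:
  "sorted_wrt (\<ge>) \<nu> \<Longrightarrow>
    \<nu> = filter (\<lambda>x. x \<noteq> 0) \<nu> @ replicate (length \<nu> - length (filter (\<lambda>x. x \<noteq> 0) \<nu>)) (0 :: nat)"
proof (induction \<nu>)
  case (Cons x \<nu>)
  show ?case
  proof (cases "x = 0")
    case True
    then have z: "\<forall>y\<in>set \<nu>. y = 0" using Cons.prems by auto
    then have "filter (\<lambda>x. x \<noteq> 0) \<nu> = []" by (simp add: filter_empty_conv)
    moreover have "replicate (length \<nu>) 0 = \<nu>" using z by (intro replicate_length_same) auto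
    ultimately show ?thesis using True by simp
  qed (use Cons in auto)
qed simp

lemma strictly_decreasing_same_image:
  fixes a b :: "nat \<Rightarrow> int"
  assumes "\<And>i j. i < j \<Longrightarrow> j < N \<Longrightarrow> a j < a i" "\<And>i j. i < j \<Longrightarrow> j < N \<Longrightarrow> b j < b i"
    and "a ` {..<N} = b ` {..<N}" "i < N"
  shows "a i = b i"
proof -
  have s: "sorted_wrt (<) (rev (map f [0..<N]))" if "\<And>i j. i < j \<Longrightarrow> j < N \<Longrightarrow> f j < f i"
    for f :: "nat \<Rightarrow> int"
    unfolding sorted_wrt_rev by (auto simp: sorted_wrt_iff_nth_less that)
  have "rev (map a [0..<N]) = rev (map b [0..<N])"
    using s[of a] s[of b] assms by (intro strict_sorted_equal) (auto simp: atLeast0LessThan)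
  then show ?thesis using assms(4) by simp
qed

text \<open>Both sides alternate under permutations of \<open>c\<close>, and for a strictly decreasing \<open>c\<close> only the
  identity can contribute on the right.\<close>

lemma hall_jt:
  assumes len: "length \<nu> = N" and dec: "sorted_wrt (\<ge>) \<nu>" and b: "\<And>i. i < N \<Longrightarrow> b i = int (\<nu> ! i) - int i"
  shows "hall (jt N c) (jt N b) =
    (\<Sum>p | p permutes {0..<N}. of_int (sign p) * (if \<forall>i<N. c i = b (p i) then 1 else 0))"
proof -
  have dec_vec: "int (\<xi> ! j) - int j < int (\<xi> ! i) - int i"
    if "sorted_wrt (\<ge>) \<xi>" "length \<xi> = N" "i < j" "j < N" for i j and \<xi> :: "nat list"
  proof -
    have "\<xi> ! j \<le> \<xi> ! i" using that by (simp add: sorted_wrt_iff_nth_less)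
    then show ?thesis using that by linarith
  qed
  have b_dec: "b j < b i" if "i < j" "j < N" for i j using dec_vec[OF dec len that] b that by simp
  have b_inj: "i = j" if "b i = b j" "i < N" "j < N" for i j
    using b_dec[of i j] b_dec[of j i] that by (cases i j rule: linorder_cases) auto
  have jtb: "jt N b = schur (filter (\<lambda>x. x \<noteq> 0) \<nu>)"
  proof -
    have "jt N b = jt N (\<lambda>i. int (\<nu> ! i) - int i)" by (rule jt_cong) (rule b)
    then show ?thesis using jt_sorted[OF dec] len by simp
  qed
  have perm: "p i < N" if "p permutes {0..<N}" "i < N" for p i
    using permutes_in_image[OF that(1), of i] that(2) by simp
  have zero: "(\<Sum>p | p permutes {0..<N}. of_int (sign p) * (if \<forall>i<N. c i = b (p i) then 1 else 0 :: rat)) = 0"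
    if no: "\<And>p. p permutes {0..<N} \<Longrightarrow> \<not> (\<forall>i<N. c i = b (p i))"
  proof (rule sum.neutral, rule ballI)
    fix p assume "p \<in> {p. p permutes {0..<N}}"
    then show "of_int (sign p) * (if \<forall>i<N. c i = b (p i) then 1 else 0 :: rat) = 0"
      using no[of p] by simp
  qed
  show ?thesis
  proof (cases "inj_on c {..<N} \<and> (\<forall>i<N. c i > - int N)")
    case False
    then consider "\<not> inj_on c {..<N}" | i where "i < N" "c i \<le> - int N" by force
    then show ?thesis
    proof cases
      case 1
      then obtain i j where ij: "i < N" "j < N" "i \<noteq> j" "c i = c j" by (auto simp: inj_on_def)
      have "\<not> (\<forall>i<N. c i = b (p i))" if "p permutes {0..<N}" for p
      proof
        assume "\<forall>i<N. c i = b (p i)"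
        then have "p i = p j" using b_inj ij perm[OF that] by metis
        then show False using ij(3) permutes_inj[OF that] by (auto dest: injD)
      qed
      from zero[OF this] show ?thesis using jt_repeated[OF ij] by simp
    next
      case 2
      have "\<not> (\<forall>i<N. c i = b (p i))" if "p permutes {0..<N}" for p
      proof
        assume "\<forall>i<N. c i = b (p i)"
        then have "c i \<ge> - int (p i)" using 2(1) b perm[OF that] by simp
        then show False using 2 perm[OF that 2(1)] by simp
      qed
      from zero[OF this] show ?thesis using jt_low_entry[of i N c] 2 by simp
    qed
  next
    case True
    then obtain q \<xi> where q: "q permutes {0..<N}" and \<xi>: "length \<xi> = N" "sorted_wrt (\<ge>) \<xi>"
      and c: "\<And>i. i < N \<Longrightarrow> c (q i) = int (\<xi> ! i) - int i"
      using straighten[of c N] by blast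
    have iq: "inv_into UNIV q permutes {0..<N}" "q (inv_into UNIV q i) = i" "inv_into UNIV q (q i) = i" for i
      using q by (auto simp: permutes_inv permutes_inverses)
    \<comment> \<open>If \<open>c\<close> is a rearrangement of \<open>b\<close> at all, then the permutation \<open>q\<close> that sorts it undoes \<open>p\<close>.\<close>
    have eq: "\<xi> = \<nu> \<and> p = inv_into UNIV q" if p: "p permutes {0..<N}" and match: "\<forall>i<N. c i = b (p i)" for p
    proof -
      have cq: "int (\<xi> ! i) - int i = b (p (q i))" if "i < N" for i
        using match c[OF that] perm[OF q that] by simp
      have "(\<lambda>i. int (\<xi> ! i) - int i) ` {..<N} = (\<lambda>i. b (p (q i))) ` {..<N}"
        using cq by (intro image_cong) auto
      also have "\<dots> = b ` ((\<lambda>i. p (q i)) ` {..<N})" by auto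
      also have "(\<lambda>i. p (q i)) ` {..<N} = {..<N}"
        using permutes_image[OF permutes_compose[OF q p]] by (simp add: comp_def lessThan_atLeast0)
      finally have img: "(\<lambda>i. int (\<xi> ! i) - int i) ` {..<N} = b ` {..<N}" .
      have \<xi>b: "int (\<xi> ! i) - int i = b i" if "i < N" for i
        using strictly_decreasing_same_image[of N "\<lambda>i. int (\<xi> ! i) - int i" b] dec_vec[OF \<xi>(2,1)] b_dec
          img that by blast
      then have "\<xi> = \<nu>" using len \<xi>(1) b by (intro nth_equalityI) auto
      moreover have "p i = inv_into UNIV q i" for i
      proof (cases "i < N")
        case True
        then have "b (p i) = b (inv_into UNIV q i)"
          using \<xi>b[of "inv_into UNIV q i"] cq[of "inv_into UNIV q i"] perm[OF iq(1)] iq(2) by simp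
        then show ?thesis using b_inj perm[OF p True] perm[OF iq(1) True] by blast
      next
        case False
        then show ?thesis using p iq(1) by (simp add: permutes_def)
      qed
      ultimately show ?thesis by auto
    qed
    have hall: "hall (jt N c) (jt N b) = of_int (sign q) * (if \<xi> = \<nu> then 1 else 0)"
    proof -
      have "jt N c = scale (of_int (sign q)) (schur (filter (\<lambda>x. x \<noteq> 0) \<xi>))"
        using q \<xi> c by (intro jt_straightened)
      moreover have "filter (\<lambda>x. x \<noteq> 0) \<xi> = filter (\<lambda>x. x \<noteq> 0) \<nu> \<longleftrightarrow> \<xi> = \<nu>"
      proof
        assume "filter (\<lambda>x. x \<noteq> 0) \<xi> = filter (\<lambda>x. x \<noteq> 0) \<nu>"
        then show "\<xi> = \<nu>"
          by (subst sorted_eq_filter_append[OF \<xi>(2)], subst sorted_eq_filter_append[OF dec])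
            (simp only: len \<xi>(1))
      qed simp
      moreover note filter_nonzero_partitions[OF \<xi>(2)] filter_nonzero_partitions[OF dec]
      ultimately show ?thesis
        unfolding jtb by (simp only: hall_scale_left hall_schur_left schur.coord_basis)
    qed
    show ?thesis
    proof (cases "\<xi> = \<nu>")
      case True
      have m: "\<forall>i<N. c i = b (inv_into UNIV q i)"
      proof (intro allI impI)
        fix i assume "i < N"
        then show "c i = b (inv_into UNIV q i)" using c[of "inv_into UNIV q i"] b[of "inv_into UNIV q i"] perm[OF iq(1)] iq(2) True by simp
      qed
      have "(\<Sum>p | p permutes {0..<N}. of_int (sign p) * (if \<forall>i<N. c i = b (p i) then 1 else 0 :: rat)) =
          (\<Sum>p | p permutes {0..<N}. if p = inv_into UNIV q then of_int (sign (inv_into UNIV q)) else 0)"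
        by (intro sum.cong) (use eq m in auto)
      also have "\<dots> = of_int (sign (inv_into UNIV q))"
        using iq(1) by (subst sum.delta) (auto simp: finite_permutations)
      also have "sign (inv_into UNIV q) = sign q"
        using q by (intro sign_inverse permutation_permutes[THEN iffD2]) auto
      finally show ?thesis using hall True by simp
    next
      case False
      then have "(\<Sum>p | p permutes {0..<N}. of_int (sign p) * (if \<forall>i<N. c i = b (p i) then 1 else 0 :: rat)) = 0"
        using eq zero by blast
      then show ?thesis using hall False by simp
    qed
  qed
qed

text \<open>Let \<open>a\<close> and \<open>b\<close> be the strictly decreasing sequences of the two partitions.  Pieri's rule on the
  left, and the expansion of the determinant on the right, give sums over the ways \<open>X\<close> to distribute
  \<open>n\<close> among the rows and over the permutations \<open>p\<close>, signed by \<open>p\<close>.  The terms that remain satisfy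
  \<open>a + X = b \<circ> p\<close> on the left and \<open>b - X = a \<circ> p\<close> on the right.  Replacing \<open>p\<close> by its inverse and
  permuting \<open>X\<close> accordingly exchanges the two conditions.\<close>

lemma hall_hsym_schur:
  assumes "\<kappa> \<in> partitions" "\<mu> \<in> partitions"
  shows "hall (hsym (int n) * schur \<kappa>) (schur \<mu>) = hall (schur \<kappa>) (coeff0 n (schur \<mu>))"
proof -
  \<comment> \<open>Padding to length \<open>Suc N\<close> makes the last parts 0, as Pieri's rule requires.\<close>
  define N where "N = max (length \<kappa>) (length \<mu>)"
  define pad where "pad \<xi> = \<xi> @ replicate (Suc N - length \<xi>) (0 :: nat)" for \<xi>
  define vec where "vec \<xi> i = int (pad \<xi> ! i) - int i" for \<xi> i
  have pad: "length (pad \<xi>) = Suc N" "sorted_wrt (\<ge>) (pad \<xi>)" "jt (Suc N) (vec \<xi>) = schur \<xi>"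
    if "\<xi> \<in> {\<kappa>, \<mu>}" for \<xi>
  proof -
    have zeros: "sorted_wrt (\<ge>) (replicate k (0 :: nat))" for k by (induction k) simp_all
    have \<xi>: "\<xi> \<in> partitions" using that assms by auto
    show l: "length (pad \<xi>) = Suc N" using that by (auto simp: pad_def N_def)
    show s: "sorted_wrt (\<ge>) (pad \<xi>)"
      using \<xi> by (auto simp: pad_def partitions_def sorted_wrt_append zeros)
    have "filter (\<lambda>x. x \<noteq> 0) (pad \<xi>) = \<xi>"
      using \<xi> by (auto simp: pad_def partitions_def filter_id_conv intro!: gr0I)
    then show "jt (Suc N) (vec \<xi>) = schur \<xi>"
      using jt_sorted[OF s] l by (simp add: vec_def[abs_def])
  qed
  have a: "vec \<kappa> N = - int N" by (simp add: vec_def pad_def N_def nth_append)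
  let ?X = "multisets_of_size {..<Suc N} n" and ?P = "{p. p permutes {0..<Suc N}}"
  let ?L = "\<lambda>p X. \<forall>i<Suc N. vec \<kappa> i + int (count X i) = vec \<mu> (p i)"
  let ?R = "\<lambda>p X. \<forall>i<Suc N. vec \<mu> i - int (count X i) = vec \<kappa> (p i)"
  have "hall (hsym (int n) * schur \<kappa>) (schur \<mu>) = hall (hsym (int n) * jt N (vec \<kappa>)) (jt (Suc N) (vec \<mu>))"
    using pad(3)[of \<kappa>] pad(3)[of \<mu>] jt_Suc[of "vec \<kappa>" N] a by simp
  also have "\<dots> = (\<Sum>X\<in>?X. \<Sum>p\<in>?P. of_int (sign p) * (if ?L p X then 1 else 0))"
    unfolding hsym_times_jt[of "vec \<kappa>", OF a] hall_sum_left
    by (intro sum.cong refl hall_jt[of "pad \<mu>"] pad) (simp_all add: vec_def)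
  also have "\<dots> = (\<Sum>p\<in>?P. of_int (sign p) * (\<Sum>X\<in>?X. if ?L p X then 1 else 0))"
    by (subst sum.swap) (simp add: sum_distrib_left)
  also have "\<dots> = (\<Sum>p\<in>?P. of_int (sign (inv_into UNIV p)) * (\<Sum>X\<in>?X. if ?R (inv_into UNIV p) X then 1 else 0))"
  proof (rule sum.cong[OF refl])
    fix p assume "p \<in> ?P"
    then have p: "p permutes {0..<Suc N}" by simp
    have inv: "p (inv_into UNIV p i) = i" "inv_into UNIV p (p i) = i" for i using p by (auto simp: permutes_inverses)
    have lt: "p i < Suc N" "inv_into UNIV p i < Suc N" if "i < Suc N" for i
      using that permutes_in_image[OF p, of i] permutes_in_image[OF permutes_inv[OF p], of i] by auto
    have cnt: "count (image_mset f X) (f i) = count X i" if "inj f" for f :: "nat \<Rightarrow> nat" and X i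
      using that by (induction X) (auto dest: injD)
    have mem: "image_mset f X \<in> ?X" if "f permutes {0..<Suc N}" "X \<in> ?X" for f X
      using that permutes_in_image[OF that(1)] by (auto simp: multisets_of_size_def)
    have "(\<Sum>X\<in>?X. if ?L p X then 1 else 0 :: rat) = (\<Sum>X\<in>?X. if ?R (inv_into UNIV p) X then 1 else 0)"
    proof (rule sum.reindex_bij_witness[of _ "image_mset (inv_into UNIV p)" "image_mset p"])
      fix X assume X: "X \<in> ?X"
      show "image_mset (inv_into UNIV p) (image_mset p X) = X" "image_mset p (image_mset (inv_into UNIV p) X) = X"
        by (simp_all add: multiset.map_comp comp_def inv)
      show "image_mset p X \<in> ?X" "image_mset (inv_into UNIV p) X \<in> ?X"
        using mem X p permutes_inv[OF p] by auto
      have "?R (inv_into UNIV p) (image_mset p X) \<longleftrightarrow> ?L p X"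
      proof
        assume R: "?R (inv_into UNIV p) (image_mset p X)"
        show "?L p X"
        proof (intro allI impI)
          fix i assume "i < Suc N"
          then have "vec \<mu> (p i) - int (count (image_mset p X) (p i)) = vec \<kappa> (inv_into UNIV p (p i))"
            using R lt by blast
          then show "vec \<kappa> i + int (count X i) = vec \<mu> (p i)"
            by (simp add: cnt[OF permutes_inj[OF p]] inv)
        qed
      next
        assume L: "?L p X"
        show "?R (inv_into UNIV p) (image_mset p X)"
        proof (intro allI impI)
          fix i assume "i < Suc N"
          then have "vec \<kappa> (inv_into UNIV p i) + int (count X (inv_into UNIV p i)) = vec \<mu> (p (inv_into UNIV p i))"
            using L lt by blast
          moreover have "count X (inv_into UNIV p i) = count (image_mset p X) i"
            using cnt[OF permutes_inj[OF p], of X "inv_into UNIV p i"] by (simp add: inv)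
          ultimately show "vec \<mu> i - int (count (image_mset p X) i) = vec \<kappa> (inv_into UNIV p i)"
            by (simp add: inv)
        qed
      qed
      then show "(if ?R (inv_into UNIV p) (image_mset p X) then 1 else 0 :: rat) = (if ?L p X then 1 else 0)"
        by simp
    qed
    moreover have "sign (inv_into UNIV p) = sign p"
      using p by (intro sign_inverse permutation_permutes[THEN iffD2]) auto
    ultimately show "of_int (sign p) * (\<Sum>X\<in>?X. if ?L p X then 1 else 0 :: rat) =
        of_int (sign (inv_into UNIV p)) * (\<Sum>X\<in>?X. if ?R (inv_into UNIV p) X then 1 else 0)" by simp
  qed
  also have "\<dots> = (\<Sum>p\<in>?P. of_int (sign p) * (\<Sum>X\<in>?X. if ?R p X then 1 else 0))"
    by (rule sum_permutations_inverse[symmetric])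
  also have "\<dots> = (\<Sum>X\<in>?X. \<Sum>p\<in>?P. of_int (sign p) * (if ?R p X then 1 else 0))"
    by (subst sum.swap) (simp add: sum_distrib_left)
  also have "\<dots> = hall (coeff0 n (jt (Suc N) (vec \<mu>))) (jt (Suc N) (vec \<kappa>))"
    unfolding coeff0_jt hall_sum_left
    by (intro sum.cong refl hall_jt[of "pad \<kappa>", symmetric] pad) (simp_all add: vec_def)
  also have "\<dots> = hall (schur \<kappa>) (coeff0 n (schur \<mu>))"
    using pad(3) by (simp add: hall_commute)
  finally show ?thesis .
qed

lemma hall_hsym_mult: "hall (hsym (int n) * f) g = hall f (coeff0 n g)"
proof (induction f rule: schur_induct)
  case (1 c \<mu> f)
  have "hall (hsym (int n) * schur \<mu>) g = hall (schur \<mu>) (coeff0 n g)"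
    by (induction g rule: schur_induct)
      (simp_all add: hall_add_right hall_scale_right hall_hsym_schur coeff0_add coeff0_scale 1)
  then show ?case
    using 1 by (simp add: distrib_left scale_mult_right hall_add_left hall_scale_left)
qed simp

section \<open>Adjoints of multiplication operators\<close>

lemma schur_coeff_degree:
  assumes "\<mu> \<in> partitions" "schur_coeff f \<mu> \<noteq> 0"
  obtains M where "mcoeff f M \<noteq> 0" "size M = sum_list \<mu>"
proof -
  have "hcomponent (sum_list \<mu>) f \<noteq> 0"
    using assms schur.coord_hcomponent[of \<mu> "sum_list \<mu>" f] by auto
  then obtain M where "mcoeff (hcomponent (sum_list \<mu>) f) M \<noteq> mcoeff 0 M" using sym_eqI by blast
  then show ?thesis using that[of M] by (auto split: if_splits)
qed

lemma finite_partitions_le: "finite {\<mu> \<in> partitions. sum_list \<mu> \<le> d}"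
proof -
  have "{\<mu> \<in> partitions. sum_list \<mu> \<le> d} = (\<Union>n\<le>d. parts n)" by (auto simp: parts_def)
  then show ?thesis by (simp add: finite_parts)
qed

text \<open>The Schur coefficients of the image of \<open>g\<close> under the adjoint have to be \<open>\<langle>g, f s\<^sub>\<mu>\<rangle>\<close>.  They vanish once
  \<open>|\<mu>|\<close> exceeds the degree of \<open>g\<close>, so that there is such an element.\<close>

lemma hall_U_adjoint_exists: "\<exists>k. \<forall>h. hall k h = hall g (f * h)"
proof -
  obtain d where d: "\<And>M. mcoeff g M \<noteq> 0 \<Longrightarrow> size M \<le> d" using mcoeff_bounded by blast
  let ?S = "{\<mu> \<in> partitions. sum_list \<mu> \<le> d}"
  define k where "k = (\<Sum>\<mu>\<in>?S. scale (hall g (f * schur \<mu>)) (schur \<mu>))"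
  have schur: "hall k (schur \<nu>) = hall g (f * schur \<nu>)" if \<nu>: "\<nu> \<in> partitions" for \<nu>
  proof -
    have "hall k (schur \<nu>) = (\<Sum>\<mu>\<in>?S. if \<mu> = \<nu> then hall g (f * schur \<nu>) else 0)"
      unfolding k_def hall_sum_left
      by (rule sum.cong) (use \<nu> in \<open>auto simp: hall_scale_left hall_schur_right schur.coord_basis\<close>)
    also have "\<dots> = (if sum_list \<nu> \<le> d then hall g (f * schur \<nu>) else 0)"
      using \<nu> by (simp add: finite_partitions_le)
    also have "\<dots> = hall g (f * schur \<nu>)"
    proof (cases "sum_list \<nu> \<le> d")
      case False
      have "schur_coeff g \<mu> * schur_coeff (f * schur \<nu>) \<mu> = 0" if \<mu>: "\<mu> \<in> partitions" for \<mu>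
      proof (rule ccontr)
        assume "schur_coeff g \<mu> * schur_coeff (f * schur \<nu>) \<mu> \<noteq> 0"
        then obtain M M' where M: "mcoeff g M \<noteq> 0" "size M = sum_list \<mu>"
          "mcoeff (f * schur \<nu>) M' \<noteq> 0" "size M' = sum_list \<mu>"
          by (metis schur_coeff_degree[OF \<mu>] mult_eq_0_iff)
        obtain A B where "M' = A + B" "mcoeff (schur \<nu>) B \<noteq> 0"
          using mcoeff_times_nonzero[OF M(3)] by metis
        then have "size M' \<ge> sum_list \<nu>" using homogeneousD[OF homogeneous_schur] by fastforce
        then show False using d[OF M(1)] M(2,4) False by simp
      qed
      then have "hall g (f * schur \<nu>) = 0" unfolding hall_def by (intro sum.neutral) auto
      then show ?thesis using False by simp
    qed simp
    finally show ?thesis .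
  qed
  have "hall k h = hall g (f * h)" for h
    by (induction h rule: schur_induct)
      (simp_all add: hall_add_right hall_scale_right schur distrib_left scale_mult_right)
  then show ?thesis by blast
qed

lemma D_op_adjoint: "hall (D_op f g) h = hall g (f * h)"
proof -
  obtain D where D: "\<And>g h. hall (D g) h = hall g (f * h)"
    using hall_U_adjoint_exists[of _ f] by metis
  have "\<exists>!D. \<forall>g h. hall (D g) h = hall g (U_op f h)"
  proof (rule ex1I[of _ D])
    fix D' assume "\<forall>g h. hall (D' g) h = hall g (U_op f h)"
    then show "D' = D" using D by (intro ext hall_nondegenerate) (simp add: U_op_def)
  qed (simp add: D U_op_def)
  from theI'[OF this] show ?thesis unfolding D_op_def[symmetric] by (simp add: U_op_def)
qed

section \<open>Uniqueness of finite expansions\<close>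

lemma finite_expansions_uniqueI:
  assumes indep: "\<And>A B c \<alpha> \<beta>. finite A \<Longrightarrow> A \<subseteq> partitions \<Longrightarrow> finite B \<Longrightarrow> B \<subseteq> partitions \<Longrightarrow>
      (\<And>g. (\<Sum>\<alpha>\<in>A. \<Sum>\<beta>\<in>B. scale (c \<alpha> \<beta>) (P (schur \<alpha>) (Q (schur \<beta>) g))) = 0) \<Longrightarrow>
      \<alpha> \<in> A \<Longrightarrow> \<beta> \<in> B \<Longrightarrow> c \<alpha> \<beta> = 0"
  shows "finite_expansions_unique P Q"
  unfolding finite_expansions_unique_def
proof (intro allI impI)
  fix M a b assume ab: "is_finite_expansion P Q M a" "is_finite_expansion P Q M b"
  let ?S = "{x. a x \<noteq> 0} \<union> {x. b x \<noteq> 0}"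
  let ?A = "fst ` ?S" and ?B = "snd ` ?S"
  have fin: "finite ?S" and sub: "?S \<subseteq> partitions \<times> partitions"
    using ab by (auto simp: is_finite_expansion_def)
  have rect: "M g = (\<Sum>\<alpha>\<in>?A. \<Sum>\<beta>\<in>?B. scale (d (\<alpha>, \<beta>)) (P (schur \<alpha>) (Q (schur \<beta>) g)))"
    if d: "is_finite_expansion P Q M d" and d': "{x. d x \<noteq> 0} \<subseteq> ?S" for d g
  proof -
    have "M g = (\<Sum>(\<alpha>, \<beta>) | d (\<alpha>, \<beta>) \<noteq> 0. scale (d (\<alpha>, \<beta>)) (P (schur \<alpha>) (Q (schur \<beta>) g)))"
      using d by (simp add: is_finite_expansion_def)
    also have "\<dots> = (\<Sum>(\<alpha>, \<beta>)\<in>?A \<times> ?B. scale (d (\<alpha>, \<beta>)) (P (schur \<alpha>) (Q (schur \<beta>) g)))"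
    proof (rule sum.mono_neutral_left)
      show "{(\<alpha>, \<beta>). d (\<alpha>, \<beta>) \<noteq> 0} \<subseteq> ?A \<times> ?B"
      proof
        fix x assume "x \<in> {(\<alpha>, \<beta>). d (\<alpha>, \<beta>) \<noteq> 0}"
        then have "x \<in> ?S" using d' by auto
        then show "x \<in> ?A \<times> ?B" by (simp add: mem_Times_iff)
      qed
    qed (use fin in auto)
    finally show ?thesis by (simp add: sum.cartesian_product)
  qed
  have z: "(\<Sum>\<alpha>\<in>?A. \<Sum>\<beta>\<in>?B. scale (a (\<alpha>, \<beta>) - b (\<alpha>, \<beta>)) (P (schur \<alpha>) (Q (schur \<beta>) g))) = 0" for g
  proof -
    have "(\<Sum>\<alpha>\<in>?A. \<Sum>\<beta>\<in>?B. scale (a (\<alpha>, \<beta>) - b (\<alpha>, \<beta>)) (P (schur \<alpha>) (Q (schur \<beta>) g))) = M g - M g"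
      unfolding sym.scale_left_diff_distrib sum_subtractf
      unfolding rect[OF ab(1) Un_upper1, symmetric] rect[OF ab(2) Un_upper2, symmetric] ..
    then show ?thesis by simp
  qed
  have "a x = b x" for x
  proof (cases "x \<in> ?S")
    case True
    then have "a (fst x, snd x) - b (fst x, snd x) = 0"
      using fin sub by (intro indep[of ?A ?B "\<lambda>\<alpha> \<beta>. a (\<alpha>, \<beta>) - b (\<alpha>, \<beta>)", OF _ _ _ _ z]) auto
    then show ?thesis by simp
  qed simp
  then show "a = b" ..
qed

subsection \<open>Multiplications and their adjoints\<close>

lemma D_op_low_degree:
  assumes "\<beta> \<in> partitions" "\<gamma> \<in> partitions" "sum_list \<gamma> \<le> sum_list \<beta>"
  shows "D_op (schur \<beta>) (schur \<gamma>) = (if \<beta> = \<gamma> then 1 else 0)"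
proof (rule hall_nondegenerate)
  fix \<nu> assume \<nu>: "\<nu> \<in> partitions"
  have "hall (D_op (schur \<beta>) (schur \<gamma>)) (schur \<nu>) = schur_coeff (schur \<beta> * schur \<nu>) \<gamma>"
    using assms by (simp add: D_op_adjoint hall_schur_left)
  also have "\<dots> = (if \<nu> = [] \<and> \<beta> = \<gamma> then 1 else 0)"
  proof (cases "\<nu> = []")
    case True
    then show ?thesis using assms by (simp add: schur_Nil schur.coord_basis)
  next
    case False
    then have "sum_list \<nu> > 0" using \<nu> by (cases \<nu>) (auto simp: partitions_def)
    moreover have "homogeneous (sum_list \<beta> + sum_list \<nu>) (schur \<beta> * schur \<nu>)"
      by (intro homogeneous_mult homogeneous_schur)
    ultimately have "schur_coeff (schur \<beta> * schur \<nu>) \<gamma> = 0"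
      using assms by (intro schur.coord_homogeneous) auto
    then show ?thesis using False by simp
  qed
  also have "\<dots> = hall (if \<beta> = \<gamma> then 1 else 0) (schur \<nu>)"
    using \<nu> schur.coord_basis[of \<nu> "[]"] by (auto simp: hall_schur_right schur_Nil partitions_def)
  finally show "hall (D_op (schur \<beta>) (schur \<gamma>)) (schur \<nu>) = hall (if \<beta> = \<gamma> then 1 else 0) (schur \<nu>)" .
qed

text \<open>Apply a relation to the Schur function of a partition \<open>\<gamma>\<close> of minimal size among the second indices
  that occur: all adjoints but the one for \<open>\<gamma>\<close> send it to 0.\<close>

lemma unique_U_D: "finite_expansions_unique U_op D_op"
proof (rule finite_expansions_uniqueI, rule ccontr)
  fix A B \<alpha> \<beta> and c :: "nat list \<Rightarrow> nat list \<Rightarrow> rat"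
  assume A: "finite A" "A \<subseteq> partitions" and B: "finite B" "B \<subseteq> partitions"
    and rel: "\<And>g. (\<Sum>\<alpha>\<in>A. \<Sum>\<beta>\<in>B. scale (c \<alpha> \<beta>) (U_op (schur \<alpha>) (D_op (schur \<beta>) g))) = 0"
    and ab: "\<alpha> \<in> A" "\<beta> \<in> B" "c \<alpha> \<beta> \<noteq> 0"
  let ?T = "{\<beta> \<in> B. \<exists>\<alpha>\<in>A. c \<alpha> \<beta> \<noteq> 0}"
  have "\<exists>\<gamma>. \<gamma> \<in> ?T \<and> (\<forall>\<beta>. \<beta> \<in> ?T \<longrightarrow> sum_list \<gamma> \<le> sum_list \<beta>)"
    using ab by (intro ex_has_least_nat[of "\<lambda>\<beta>. \<beta> \<in> ?T" \<beta>]) auto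
  then obtain \<gamma> where \<gamma>: "\<gamma> \<in> ?T" and min: "\<And>\<beta>. \<beta> \<in> ?T \<Longrightarrow> sum_list \<gamma> \<le> sum_list \<beta>" by blast
  have "scale (c \<alpha> \<beta>) (U_op (schur \<alpha>) (D_op (schur \<beta>) (schur \<gamma>))) =
      (if \<beta> = \<gamma> then scale (c \<alpha> \<gamma>) (schur \<alpha>) else 0)" if "\<alpha> \<in> A" "\<beta> \<in> B" for \<alpha> \<beta>
  proof (cases "c \<alpha> \<beta> = 0")
    case False
    then have "sum_list \<gamma> \<le> sum_list \<beta>" using min that by auto
    moreover have "\<beta> \<in> partitions" "\<gamma> \<in> partitions" using that B(2) \<gamma> by auto
    ultimately show ?thesis by (simp add: U_op_def D_op_low_degree)
  qed auto
  then have "(\<Sum>\<alpha>\<in>A. \<Sum>\<beta>\<in>B. scale (c \<alpha> \<beta>) (U_op (schur \<alpha>) (D_op (schur \<beta>) (schur \<gamma>)))) =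
      (\<Sum>\<alpha>\<in>A. \<Sum>\<beta>\<in>B. if \<beta> = \<gamma> then scale (c \<alpha> \<gamma>) (schur \<alpha>) else 0)"
    by (intro sum.cong refl) auto
  also have "\<dots> = (\<Sum>\<alpha>\<in>A. scale (c \<alpha> \<gamma>) (schur \<alpha>))" using B \<gamma> by (simp add: sum.delta)
  finally have "(\<Sum>\<alpha>\<in>A. scale (c \<alpha> \<gamma>) (schur \<alpha>)) = 0" using rel by simp
  then have "\<forall>\<alpha>\<in>A. c \<alpha> \<gamma> = 0" using schur.relation_trivial[OF A, of "\<lambda>\<alpha>. c \<alpha> \<gamma>"] by blast
  then show False using \<gamma> by auto
qed

lemma constant_if_coeff0_zero:
  assumes "\<And>n. n \<ge> 1 \<Longrightarrow> coeff0 n f = 0"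
  shows "f = scale (mcoeff f {#}) 1"
proof (rule sym_eqI)
  fix M
  show "mcoeff f M = mcoeff (scale (mcoeff f {#}) 1) M"
  proof (cases "M = {#}")
    case False
    then obtain x where x: "x \<in># M" by blast
    define \<tau> where "\<tau> = Transposition.transpose x (0 :: nat)"
    have \<tau>: "bij \<tau>" "\<tau> x = 0" by (simp_all add: \<tau>_def)
    obtain n B where nB: "image_mset \<tau> M = insert0 n B" using insert0_surj by blast
    have "0 \<in># image_mset \<tau> M" using x \<tau>(2) by (metis image_eqI set_image_mset)
    then have "n \<ge> 1" unfolding nB by (auto split: if_splits)
    have "mcoeff f M = mcoeff (coeff0 n f) B"
      using mcoeff_perm[OF \<tau>(1), of f M] by (simp add: nB coeff0.rep_eq)
    then show ?thesis using assms[OF \<open>n \<ge> 1\<close>] False by (simp add: one_sym.rep_eq)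
  qed (simp add: one_sym.rep_eq)
qed

text \<open>The element \<open>\<Sum>\<^sub>i e\<^sub>i \<otimes> f\<^sub>i\<close> of \<open>Sym \<otimes> Sym\<close> annihilates the Hall inner product when every multiple of it
  has inner product zero.  Replacing \<open>g\<close> by \<open>h\<^sub>n g\<close> and moving \<open>h\<^sub>n\<close> to the other side, the coefficient of
  the \<open>n\<close>-th power of the first variable in \<open>f\<^sub>i h\<close> is a sum of products; by induction all but the one
  with the \<open>n\<close>-th coefficient of \<open>f\<^sub>i\<close> contribute 0.\<close>

lemma annihilator_coeff0:
  assumes ann: "\<And>g h. (\<Sum>i\<in>I. hall (e i * g) (f i * h)) = 0"
  shows "(\<Sum>i\<in>I. hall (e i * g) (coeff0 n (f i) * h)) = 0"
proof (induction n arbitrary: g h rule: less_induct)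
  case (less n)
  have "0 = (\<Sum>i\<in>I. hall (e i * (hsym (int n) * g)) (f i * h))" using ann by simp
  also have "\<dots> = (\<Sum>i\<in>I. hall (e i * g) (coeff0 n (f i * h)))"
    unfolding mult.left_commute[of _ "hsym (int n)"] hall_hsym_mult ..
  also have "\<dots> = (\<Sum>k\<le>n. \<Sum>i\<in>I. hall (e i * g) (coeff0 k (f i) * coeff0 (n - k) h))"
    unfolding coeff0_mult hall_sum_right by (rule sum.swap)
  also have "\<dots> = (\<Sum>k\<in>{n}. \<Sum>i\<in>I. hall (e i * g) (coeff0 k (f i) * coeff0 (n - k) h))"
    by (rule sum.mono_neutral_right) (use less in auto)
  finally show ?case by simp
qed

text \<open>Taking coefficients lowers degrees, so that all \<open>f\<^sub>i\<close> may be supposed constant.\<close>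

lemma annihilator_trivial:
  assumes indep: "\<And>c i. (\<Sum>i\<in>I. scale (c i) (e i)) = 0 \<Longrightarrow> i \<in> I \<Longrightarrow> c i = 0"
    and ann: "\<And>g h. (\<Sum>i\<in>I. hall (e i * g) (f i * h)) = 0"
    and deg: "\<And>i M. i \<in> I \<Longrightarrow> mcoeff (f i) M \<noteq> 0 \<Longrightarrow> size M < d"
    and "i \<in> I"
  shows "f i = 0"
  using ann deg \<open>i \<in> I\<close>
proof (induction d arbitrary: f i)
  case 0
  then show ?case by (intro sym_eqI) auto
next
  case (Suc d)
  have "coeff0 n (f j) = 0" if n: "n \<ge> 1" and j: "j \<in> I" for n j
  proof (rule Suc.IH)
    show "(\<Sum>i\<in>I. hall (e i * g) (coeff0 n (f i) * h)) = 0" for g h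
      using Suc.prems(1) by (rule annihilator_coeff0)
    show "size M < d" if "k \<in> I" "mcoeff (coeff0 n (f k)) M \<noteq> 0" for k M
      using Suc.prems(2)[of k "insert0 n M"] that n by (simp add: coeff0.rep_eq)
  qed (rule j)
  then have const: "f j = scale (mcoeff (f j) {#}) 1" if "j \<in> I" for j
    using constant_if_coeff0_zero that by blast
  have "(\<Sum>j\<in>I. scale (mcoeff (f j) {#}) (e j)) = 0"
  proof (rule hall_nondegenerate)
    fix \<mu>
    have "hall (\<Sum>j\<in>I. scale (mcoeff (f j) {#}) (e j)) (schur \<mu>) =
        (\<Sum>j\<in>I. hall (e j * 1) (scale (mcoeff (f j) {#}) 1 * schur \<mu>))"
      by (simp add: hall_sum_left hall_scale_left hall_scale_right scale_mult_left)
    also have "\<dots> = (\<Sum>j\<in>I. hall (e j * 1) (f j * schur \<mu>))"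
      by (rule sum.cong) (simp_all flip: const)
    finally show "hall (\<Sum>j\<in>I. scale (mcoeff (f j) {#}) (e j)) (schur \<mu>) = hall 0 (schur \<mu>)"
      using Suc.prems(1)[of 1 "schur \<mu>"] by simp
  qed
  then have "mcoeff (f i) {#} = 0" using Suc.prems(3) by (rule indep)
  then show ?case using const[OF Suc.prems(3)] by simp
qed

lemma unique_D_U: "finite_expansions_unique D_op U_op"
proof (rule finite_expansions_uniqueI)
  fix A B \<alpha> \<beta> and c :: "nat list \<Rightarrow> nat list \<Rightarrow> rat"
  assume A: "finite A" "A \<subseteq> partitions" and B: "finite B" "B \<subseteq> partitions"
    and rel: "\<And>g. (\<Sum>\<alpha>\<in>A. \<Sum>\<beta>\<in>B. scale (c \<alpha> \<beta>) (D_op (schur \<alpha>) (U_op (schur \<beta>) g))) = 0"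
    and ab: "\<alpha> \<in> A" "\<beta> \<in> B"
  define f where "f \<alpha> = (\<Sum>\<beta>\<in>B. scale (c \<alpha> \<beta>) (schur \<beta>))" for \<alpha>
  have "\<exists>d. \<forall>M. mcoeff (f \<alpha>) M \<noteq> 0 \<longrightarrow> size M < d" for \<alpha>
    by (rule mcoeff_bounded[of "f \<alpha>"]) (metis less_Suc_eq_le)
  then obtain d where d: "\<And>\<alpha> M. mcoeff (f \<alpha>) M \<noteq> 0 \<Longrightarrow> size M < d \<alpha>" by metis
  have "f \<alpha> = 0"
  proof (rule annihilator_trivial[where I = A and e = schur and d = "Max (d ` A)"])
    show "c i = 0" if "(\<Sum>i\<in>A. scale (c i) (schur i)) = 0" "i \<in> A" for c i
      using schur.relation_trivial[OF A that] .
    show "(\<Sum>\<alpha>\<in>A. hall (schur \<alpha> * g) (f \<alpha> * h)) = 0" for g h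
    proof -
      have "(\<Sum>\<alpha>\<in>A. hall (schur \<alpha> * g) (f \<alpha> * h)) =
          (\<Sum>\<alpha>\<in>A. \<Sum>\<beta>\<in>B. c \<alpha> \<beta> * hall (D_op (schur \<alpha>) (schur \<beta> * h)) g)"
        by (simp add: f_def sum_distrib_right scale_mult_left hall_sum_right hall_scale_right
            D_op_adjoint hall_commute[of "_ * g"])
      also have "\<dots> = hall (\<Sum>\<alpha>\<in>A. \<Sum>\<beta>\<in>B. scale (c \<alpha> \<beta>) (D_op (schur \<alpha>) (U_op (schur \<beta>) h))) g"
        by (simp add: hall_sum_left hall_scale_left U_op_def)
      finally show ?thesis using rel by simp
    qed
    show "size M < Max (d ` A)" if "i \<in> A" "mcoeff (f i) M \<noteq> 0" for i M
      using d[OF that(2)] that(1) A(1) by (meson Max_ge finite_imageI imageI less_le_trans)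
  qed (rule ab)
  then show "c \<alpha> \<beta> = 0" using schur.relation_trivial[OF B, of "c \<alpha>"] ab by (simp add: f_def)
qed

subsection \<open>Operators that are diagonal on power sums\<close>

text \<open>Kronecker multiplication by a symmetric function that may depend on the degree has the power sums as
  eigenvectors.\<close>

locale power_sum_diagonal =
  fixes Q :: "sym \<Rightarrow> sym \<Rightarrow> sym" and eig :: "nat list \<Rightarrow> nat list \<Rightarrow> rat"
  assumes diagonal: "\<beta> \<in> partitions \<Longrightarrow> \<mu> \<in> partitions \<Longrightarrow>
      power_sum_coeff (Q (schur \<beta>) g) \<mu> = eig \<beta> \<mu> * power_sum_coeff g \<mu>"
    and eigenvalues_independent: "finite B \<Longrightarrow> B \<subseteq> partitions \<Longrightarrow>
      (\<And>\<mu>. \<mu> \<in> partitions \<Longrightarrow> (\<Sum>\<beta>\<in>B. k \<beta> * eig \<beta> \<mu>) = 0) \<Longrightarrow> \<beta> \<in> B \<Longrightarrow> k \<beta> = 0"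

lemma power_sum_nonzero: "\<mu> \<in> partitions \<Longrightarrow> power_sum \<mu> \<noteq> 0"
  using power_sum.coord_basis[of \<mu> \<mu>] by auto

lemma (in power_sum_diagonal) unique_U: "finite_expansions_unique U_op Q"
proof (rule finite_expansions_uniqueI)
  fix A B \<alpha> \<beta> and c :: "nat list \<Rightarrow> nat list \<Rightarrow> rat"
  assume A: "finite A" "A \<subseteq> partitions" and B: "finite B" "B \<subseteq> partitions"
    and rel: "\<And>g. (\<Sum>\<alpha>\<in>A. \<Sum>\<beta>\<in>B. scale (c \<alpha> \<beta>) (U_op (schur \<alpha>) (Q (schur \<beta>) g))) = 0"
    and ab: "\<alpha> \<in> A" "\<beta> \<in> B"
  have "(\<Sum>\<beta>\<in>B. c \<alpha> \<beta> * eig \<beta> \<mu>) = 0" if \<mu>: "\<mu> \<in> partitions" for \<mu>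
  proof -
    have Q: "Q (schur \<beta>) (power_sum \<mu>) = scale (eig \<beta> \<mu>) (power_sum \<mu>)" if "\<beta> \<in> B" for \<beta>
      using that B(2) \<mu> diagonal
      by (intro power_sum.coord_eqI) (auto simp: power_sum.coord_scale power_sum.coord_basis)
    have "(\<Sum>\<alpha>\<in>A. scale (\<Sum>\<beta>\<in>B. c \<alpha> \<beta> * eig \<beta> \<mu>) (schur \<alpha>)) * power_sum \<mu> =
        (\<Sum>\<alpha>\<in>A. \<Sum>\<beta>\<in>B. scale (c \<alpha> \<beta>) (U_op (schur \<alpha>) (Q (schur \<beta>) (power_sum \<mu>))))"
      by (simp add: sum_distrib_right scale_mult_left sym.scale_sum_left U_op_def Q scale_mult_right
          cong: sum.cong)
    then have "(\<Sum>\<alpha>\<in>A. scale (\<Sum>\<beta>\<in>B. c \<alpha> \<beta> * eig \<beta> \<mu>) (schur \<alpha>)) * power_sum \<mu> = 0"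
      using rel by simp
    then have "(\<Sum>\<alpha>\<in>A. scale (\<Sum>\<beta>\<in>B. c \<alpha> \<beta> * eig \<beta> \<mu>) (schur \<alpha>)) = 0"
      using sym_no_zero_divisors power_sum_nonzero[OF \<mu>] by blast
    from schur.relation_trivial[OF A this ab(1)] show ?thesis .
  qed
  then show "c \<alpha> \<beta> = 0" using eigenvalues_independent[OF B, of "c \<alpha>"] ab(2) by blast
qed

lemma power_sum_coeff_as_hall:
  assumes \<mu>: "\<mu> \<in> partitions"
  obtains q where "q \<noteq> 0" "\<And>f. power_sum_coeff f \<mu> = hall q f"
proof -
  define q where "q = (\<Sum>\<nu>\<in>parts (sum_list \<mu>). scale (power_sum_coeff (schur \<nu>) \<mu>) (schur \<nu>))"
  have schur: "hall q (schur \<nu>) = power_sum_coeff (schur \<nu>) \<mu>" if \<nu>: "\<nu> \<in> partitions" for \<nu>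
  proof -
    have "hall q (schur \<nu>) = (\<Sum>\<xi>\<in>parts (sum_list \<mu>). if \<xi> = \<nu> then power_sum_coeff (schur \<nu>) \<mu> else 0)"
      unfolding q_def hall_sum_left
      by (rule sum.cong)
        (use \<nu> in \<open>auto simp: parts_def hall_scale_left hall_schur_right schur.coord_basis\<close>)
    also have "\<dots> = (if sum_list \<nu> = sum_list \<mu> then power_sum_coeff (schur \<nu>) \<mu> else 0)"
      using \<nu> finite_parts by (simp add: parts_def)
    also have "\<dots> = power_sum_coeff (schur \<nu>) \<mu>"
      using power_sum.coord_homogeneous[OF homogeneous_schur \<mu>, of \<nu>] by auto
    finally show ?thesis .
  qed
  have q: "power_sum_coeff f \<mu> = hall q f" for f
    by (induction f rule: schur_induct)
      (simp_all add: schur hall_add_right hall_scale_right power_sum.coord_add power_sum.coord_scale)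
  moreover have "q \<noteq> 0" using q[of "power_sum \<mu>"] power_sum.coord_basis[OF \<mu> \<mu>] by auto
  ultimately show ?thesis by (rule that[rotated])
qed

text \<open>A coordinate of the adjoint of multiplication by \<open>f\<close> is the inner product with a nonzero multiple
  of \<open>f\<close>, hence vanishes identically only if \<open>f = 0\<close>.\<close>

lemma (in power_sum_diagonal) unique_D: "finite_expansions_unique Q D_op"
proof (rule finite_expansions_uniqueI)
  fix A B \<alpha> \<beta> and c :: "nat list \<Rightarrow> nat list \<Rightarrow> rat"
  assume A: "finite A" "A \<subseteq> partitions" and B: "finite B" "B \<subseteq> partitions"
    and rel: "\<And>g. (\<Sum>\<alpha>\<in>A. \<Sum>\<beta>\<in>B. scale (c \<alpha> \<beta>) (Q (schur \<alpha>) (D_op (schur \<beta>) g))) = 0"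
    and ab: "\<alpha> \<in> A" "\<beta> \<in> B"
  have "(\<Sum>\<alpha>\<in>A. c \<alpha> \<beta> * eig \<alpha> \<mu>) = 0" if \<mu>: "\<mu> \<in> partitions" for \<mu>
  proof -
    obtain q where q: "q \<noteq> 0" "\<And>f. power_sum_coeff f \<mu> = hall q f"
      using power_sum_coeff_as_hall[OF \<mu>] by blast
    define k where "k \<beta> = (\<Sum>\<alpha>\<in>A. c \<alpha> \<beta> * eig \<alpha> \<mu>)" for \<beta>
    define b where "b = (\<Sum>\<beta>\<in>B. scale (k \<beta>) (schur \<beta>))"
    have "b * q = 0"
    proof (rule hall_nondegenerate)
      fix \<nu>
      let ?g = "schur \<nu>"
      have "hall (b * q) ?g = (\<Sum>\<beta>\<in>B. k \<beta> * power_sum_coeff (D_op (schur \<beta>) ?g) \<mu>)"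
        by (simp add: b_def sum_distrib_right scale_mult_left hall_sum_left hall_scale_left q(2)
            hall_commute[of q] D_op_adjoint hall_commute[of "_ * q"])
      also have "\<dots> = (\<Sum>\<beta>\<in>B. \<Sum>\<alpha>\<in>A. c \<alpha> \<beta> * (eig \<alpha> \<mu> * power_sum_coeff (D_op (schur \<beta>) ?g) \<mu>))"
        by (simp add: k_def sum_distrib_right mult.assoc)
      also have "\<dots> = (\<Sum>\<beta>\<in>B. \<Sum>\<alpha>\<in>A. c \<alpha> \<beta> * power_sum_coeff (Q (schur \<alpha>) (D_op (schur \<beta>) ?g)) \<mu>)"
        using A(2) \<mu> by (intro sum.cong refl) (auto simp: diagonal)
      also have "\<dots> = power_sum_coeff
          (\<Sum>\<alpha>\<in>A. \<Sum>\<beta>\<in>B. scale (c \<alpha> \<beta>) (Q (schur \<alpha>) (D_op (schur \<beta>) ?g))) \<mu>"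
        by (subst sum.swap) (simp add: power_sum.coord_sum power_sum.coord_scale)
      finally show "hall (b * q) ?g = hall 0 ?g" using rel by simp
    qed
    then have "b = 0" using sym_no_zero_divisors q(1) by blast
    then have "k \<beta> = 0" using schur.relation_trivial[OF B, of k] ab(2) by (simp add: b_def)
    then show ?thesis by (simp add: k_def)
  qed
  then show "c \<alpha> \<beta> = 0" using eigenvalues_independent[OF A, of "\<lambda>\<alpha>. c \<alpha> \<beta>"] ab(1) by blast
qed

lemma power_sum_coeff_kronecker:
  assumes "\<mu> \<in> partitions"
  shows "power_sum_coeff (kronecker f g) \<mu> = power_sum_coeff f \<mu> * of_nat (zee \<mu>) * power_sum_coeff g \<mu>"
proof -
  let ?S = "{\<mu> \<in> partitions. power_sum_coeff f \<mu> \<noteq> 0}"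
  have "power_sum_coeff (kronecker f g) \<mu> =
      (\<Sum>\<nu>\<in>?S. if \<nu> = \<mu> then power_sum_coeff f \<mu> * power_sum_coeff g \<mu> * of_nat (zee \<mu>) else 0)"
    unfolding kronecker_def power_sum.coord_sum
    by (rule sum.cong) (use assms in \<open>auto simp: power_sum.coord_scale power_sum.coord_basis\<close>)
  also have "\<dots> = power_sum_coeff f \<mu> * of_nat (zee \<mu>) * power_sum_coeff g \<mu>"
    using assms power_sum.finite_coord[of f] by simp
  finally show ?thesis .
qed

lemma zee_nonzero: "\<mu> \<in> partitions \<Longrightarrow> zee \<mu> \<noteq> 0"
  by (auto simp: zee_def partitions_def)

interpretation K: power_sum_diagonal K_op "\<lambda>\<beta> \<mu>. power_sum_coeff (schur \<beta>) \<mu> * of_nat (zee \<mu>)"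
proof
  fix B k \<beta>
  assume B: "finite B" "B \<subseteq> partitions" and "\<beta> \<in> B"
    and z: "\<And>\<mu>. \<mu> \<in> partitions \<Longrightarrow> (\<Sum>\<beta>\<in>B. k \<beta> * (power_sum_coeff (schur \<beta>) \<mu> * of_nat (zee \<mu>))) = 0"
  have "(\<Sum>\<beta>\<in>B. scale (k \<beta>) (schur \<beta>)) = 0"
  proof (rule power_sum.coord_eqI)
    fix \<mu> assume \<mu>: "\<mu> \<in> partitions"
    have "(\<Sum>\<beta>\<in>B. k \<beta> * power_sum_coeff (schur \<beta>) \<mu>) * of_nat (zee \<mu>) = 0"
      using z[OF \<mu>] by (simp add: sum_distrib_right mult.assoc)
    then show "power_sum_coeff (\<Sum>\<beta>\<in>B. scale (k \<beta>) (schur \<beta>)) \<mu> = power_sum_coeff 0 \<mu>"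
      using zee_nonzero[OF \<mu>] by (simp add: power_sum.coord_sum power_sum.coord_scale)
  qed
  then show "k \<beta> = 0" using schur.relation_trivial[OF B] \<open>\<beta> \<in> B\<close> by blast
qed (simp add: K_op_def power_sum_coeff_kronecker)

definition padded_schur :: "nat \<Rightarrow> nat list \<Rightarrow> sym" where
  "padded_schur n \<beta> = jacobi_trudi ((int n - int (sum_list \<beta>)) # map int \<beta>)"

lemma Kbar_op_schur:
  assumes "\<beta> \<in> partitions"
  shows "Kbar_op (schur \<beta>) g = Kbar_part \<beta> g"
proof -
  have "{\<mu>. \<mu> \<in> partitions \<and> schur_coeff (schur \<beta>) \<mu> \<noteq> 0} = {\<beta>}"
    using assms by (auto simp: schur.coord_basis split: if_splits)
  then show ?thesis using assms by (simp add: Kbar_op_def schur.coord_basis)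
qed

lemma power_sum_coeff_Kbar:
  assumes "\<beta> \<in> partitions" "\<mu> \<in> partitions"
  shows "power_sum_coeff (Kbar_op (schur \<beta>) g) \<mu> =
    power_sum_coeff (padded_schur (sum_list \<mu>) \<beta>) \<mu> * of_nat (zee \<mu>) * power_sum_coeff g \<mu>"
proof -
  let ?e = "power_sum_coeff (padded_schur (sum_list \<mu>) \<beta>) \<mu> * of_nat (zee \<mu>) * power_sum_coeff g \<mu>"
  have "power_sum_coeff (Kbar_op (schur \<beta>) g) \<mu> =
      (\<Sum>n | hcomponent n g \<noteq> 0. if n = sum_list \<mu> then ?e else 0)"
    unfolding Kbar_op_schur[OF assms(1)] Kbar_part_def power_sum.coord_sum
    by (rule sum.cong)
      (use assms in \<open>auto simp: power_sum_coeff_kronecker power_sum.coord_hcomponent padded_schur_def\<close>)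
  also have "\<dots> = (if hcomponent (sum_list \<mu>) g \<noteq> 0 then ?e else 0)"
    by (simp add: finite_hcomponents)
  also have "\<dots> = ?e"
    using power_sum.coord_hcomponent[OF assms(2), of "sum_list \<mu>" g] by auto
  finally show ?thesis .
qed

text \<open>For large \<open>n\<close>, the sequences \<open>(n - |\<beta>|, \<beta>)\<close> are distinct partitions, so that already the
  eigenvalues in degree \<open>n\<close> are linearly independent.\<close>

interpretation Kbar: power_sum_diagonal Kbar_op
  "\<lambda>\<beta> \<mu>. power_sum_coeff (padded_schur (sum_list \<mu>) \<beta>) \<mu> * of_nat (zee \<mu>)"
proof
  fix B k \<beta>
  assume B: "finite B" "B \<subseteq> partitions" and "\<beta> \<in> B"
    and z: "\<And>\<mu>. \<mu> \<in> partitions \<Longrightarrow>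
      (\<Sum>\<beta>\<in>B. k \<beta> * (power_sum_coeff (padded_schur (sum_list \<mu>) \<beta>) \<mu> * of_nat (zee \<mu>))) = 0"
  \<comment> \<open>As \<open>n > 2 |\<beta>|\<close>, the new first part \<open>n - |\<beta>|\<close> exceeds all parts of \<open>\<beta>\<close>.\<close>
  define n where "n = Suc (\<Sum>\<beta>\<in>B. 2 * sum_list \<beta>)"
  define pad where "pad \<beta> = (n - sum_list \<beta>) # \<beta>" for \<beta>
  have n: "n > 2 * sum_list \<beta>" if "\<beta> \<in> B" for \<beta>
    using member_le_sum[OF that, of "\<lambda>\<beta>. 2 * sum_list \<beta>"] B(1) by (simp add: n_def)
  have pad: "pad \<beta> \<in> partitions" "sum_list (pad \<beta>) = n" "padded_schur n \<beta> = schur (pad \<beta>)"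
    if "\<beta> \<in> B" for \<beta>
  proof -
    have "x \<le> n - sum_list \<beta>" if "x \<in> set \<beta>" for x
      using member_le_sum_list[OF that] n[OF \<open>\<beta> \<in> B\<close>] by simp
    then show "pad \<beta> \<in> partitions" using B(2) that n[OF that] by (auto simp: pad_def partitions_def)
    show "sum_list (pad \<beta>) = n" using n[OF that] by (simp add: pad_def)
    show "padded_schur n \<beta> = schur (pad \<beta>)"
      using n[OF that] by (simp add: padded_schur_def schur_def pad_def of_nat_diff)
  qed
  have inj: "inj_on pad B" by (auto simp: inj_on_def pad_def)
  have "(\<Sum>\<beta>\<in>B. scale (k \<beta>) (schur (pad \<beta>))) = 0"
  proof (rule power_sum.coord_eqI)
    fix \<mu> assume \<mu>: "\<mu> \<in> partitions"
    have "(\<Sum>\<beta>\<in>B. k \<beta> * power_sum_coeff (schur (pad \<beta>)) \<mu>) = 0"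
    proof (cases "sum_list \<mu> = n")
      case True
      then have "(\<Sum>\<beta>\<in>B. k \<beta> * power_sum_coeff (schur (pad \<beta>)) \<mu>) * of_nat (zee \<mu>) = 0"
        using z[OF \<mu>] pad(3) by (simp add: sum_distrib_right mult.assoc)
      then show ?thesis using zee_nonzero[OF \<mu>] by simp
    next
      case False
      have "power_sum_coeff (schur (pad \<beta>)) \<mu> = 0" if "\<beta> \<in> B" for \<beta>
        using power_sum.coord_homogeneous[OF homogeneous_schur \<mu>] pad(2)[OF that] False by simp
      then show ?thesis by simp
    qed
    then show "power_sum_coeff (\<Sum>\<beta>\<in>B. scale (k \<beta>) (schur (pad \<beta>))) \<mu> = power_sum_coeff 0 \<mu>"
      by (simp add: power_sum.coord_sum power_sum.coord_scale)
  qed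
  then have "(\<Sum>\<nu>\<in>pad ` B. scale (k (tl \<nu>)) (schur \<nu>)) = 0"
    by (simp add: sum.reindex[OF inj]) (simp add: pad_def)
  then have "k (tl (pad \<beta>)) = 0"
    using B(1) pad(1) \<open>\<beta> \<in> B\<close> by (intro schur.relation_trivial[of "pad ` B" "\<lambda>\<nu>. k (tl \<nu>)"]) auto
  then show "k \<beta> = 0" by (simp add: pad_def)
qed (rule power_sum_coeff_Kbar)

theorem proposition4p1:
  shows "finite_expansions_unique U_op D_op \<and>
         finite_expansions_unique D_op U_op \<and>
         finite_expansions_unique U_op K_op \<and>
         finite_expansions_unique K_op D_op \<and>
         finite_expansions_unique U_op Kbar_op \<and>
         finite_expansions_unique Kbar_op D_op"
  by (intro conjI unique_U_D unique_D_U K.unique_U K.unique_D Kbar.unique_U Kbar.unique_D)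

end
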